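(* Let $X$ be a Banach space with a normalised unconditional basis $(x_n)_{n=1}^\infty$. Then the following are equivalent: (1) $(x_n)$ is democratic. (2) There exists a constant $C$ such that $\|x-\mathcal{G}_N(x)\|\le C\,\sigma_N(x)$ for all $x\in X$, all $N=1,2,\dots$, and every admissible choice of $\mathcal{G}_N(x)$. (3) For all $\alpha\in(0,\infty)$ and all $q\in(0,\infty]$ there exists a constant $C$ such that $\|x\|_{\mathcal{G}^\alpha_q}\le C\|x\|_{\mathcal{A}^\alpha_q}$ for every $x\in\mathcal{A}^\alpha_q$. (3') For some $\alpha\in(0,\infty)$ and some $q\in(0,\infty]$ there exists a constant $C$ such that $\|x\|_{\mathcal{G}^\alpha_q}\le C\|x\|_{\mathcal{A}^\alpha_q}$ for every $x\in\mathcal{A}^\alpha_q$.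
   Context: Normalised means $\|x_n\|=1$ for all $n$. Democratic: the basis $(x_n)$ is democratic if there exists a constant $C$ such that for all finite sets of indices $A,B$ with $\#A=\#B$ we have $\|\sum_{n\in A}x_n\|\le C\|\sum_{n\in B}x_n\|$. Greedy operator: for $x=\sum_{n=1}^\infty a_nx_n\in X$ and $N=1,2,\dots$, put $\mathcal{G}_N(x)=\sum_{n\in\Lambda_N}a_nx_n$, where $\Lambda_N$ is any $N$-element set of indices such that $\min_{n\in\Lambda_N}|a_n|\ge\max_{n\notin\Lambda_N}|a_n|$. The set $\Lambda_N$ need not be unique; any such choice is admissible. Error of best $N$-term approximation: $\sigma_N(x)=\inf\{\|x-\sum_{n\in\Lambda}b_nx_n\| : \#\Lambda=N,\ b_n \text{ arbitrary scalars}\}$. Error of greedy approximation: $\gamma_N(x)=\max\|x-\mathcal{G}_N(x)\|$, the maximum being over all admissible choices of $\mathcal{G}_N(x)$. For $\alpha>0$ and $0<q<\infty$ define, with values in $[0,\infty]$, $$\|x\|_{\mathcal{A}^\alpha_q}=\|x\|+\left[\sum_{N=1}^\infty\left(N^\alpha\sigma_N(x)\right)^q\tfrac1N\right]^{1/q},\qquad \|x\|_{\mathcal{A}^\alpha_\infty}=\|x\|+\sup_{N\ge1}N^\alpha\sigma_N(x),$$ and $\mathcal{A}^\alpha_q=\{x\in X:\|x\|_{\mathcal{A}^\alpha_q}<\infty\}$ for $0<q\le\infty$. The quantities $\|x\|_{\mathcal{G}^\alpha_q}$, $0<q\le\infty$, are defined by the same formulas with $\sigma_N(x)$ replaced by $\gamma_N(x)$.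 *)

theory Defs
  imports "HOL-Analysis.Analysis"
begin

text \<open>
  Banach spaces over the real or the complex field.  The class \<open>banach\<close> only provides a real
  scalar multiplication, so the scalar multiplication is a parameter.  The sort of \<open>'k\<close> has the
  instances \<open>real\<close> and \<open>complex\<close>, and up to isomorphism no others (a finite-dimensional real
  field extension of the reals with multiplicative norm is one of the two).
\<close>

locale banach_over = vector_space smul
  for smul :: "'k::{real_normed_field, euclidean_space} \<Rightarrow> 'a::banach \<Rightarrow> 'a" +
  assumes norm_scale: "norm (smul c x) = norm c * norm x"
    and scale_of_real: "smul (of_real r) x = r *\<^sub>R x"

definition schauder_basis :: "('k \<Rightarrow> 'a \<Rightarrow> 'a::real_normed_vector) \<Rightarrow> (nat \<Rightarrow> 'a) \<Rightarrow> bool" where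
  "schauder_basis smul e \<longleftrightarrow> (\<forall>x. \<exists>!a. (\<lambda>n. smul (a n) (e n)) sums x)"

text \<open>
  Every basis expansion converges unconditionally; \<open>has_sum\<close> is the library's unconditional
  (order-free) notion of summation, \<open>sums\<close> the ordered one.
\<close>

definition unconditional_basis :: "('k \<Rightarrow> 'a \<Rightarrow> 'a::real_normed_vector) \<Rightarrow> (nat \<Rightarrow> 'a) \<Rightarrow> bool" where
  "unconditional_basis smul e \<longleftrightarrow> schauder_basis smul e \<and>
     (\<forall>x a. (\<lambda>n. smul (a n) (e n)) sums x \<longrightarrow> ((\<lambda>n. smul (a n) (e n)) has_sum x) UNIV)"

definition normalised :: "(nat \<Rightarrow> 'a::real_normed_vector) \<Rightarrow> bool" where
  "normalised e \<longleftrightarrow> (\<forall>n. norm (e n) = 1)"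

definition democratic :: "(nat \<Rightarrow> 'a::real_normed_vector) \<Rightarrow> bool" where
  "democratic e \<longleftrightarrow> (\<exists>C::real. \<forall>A B. finite A \<longrightarrow> finite B \<longrightarrow> card A = card B \<longrightarrow>
     norm (\<Sum>n\<in>A. e n) \<le> C * norm (\<Sum>n\<in>B. e n))"

definition basis_coeff ::
  "('k \<Rightarrow> 'a \<Rightarrow> 'a::real_normed_vector) \<Rightarrow> (nat \<Rightarrow> 'a) \<Rightarrow> 'a \<Rightarrow> nat \<Rightarrow> 'k" where
  "basis_coeff smul e x = (THE a. (\<lambda>n. smul (a n) (e n)) sums x)"

definition greedy_sets ::
  "('k::real_normed_field \<Rightarrow> 'a \<Rightarrow> 'a::real_normed_vector) \<Rightarrow> (nat \<Rightarrow> 'a) \<Rightarrow> nat \<Rightarrow> 'a \<Rightarrow> nat set set" where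
  "greedy_sets smul e N x = {\<Lambda>. finite \<Lambda> \<and> card \<Lambda> = N \<and>
     (\<forall>n\<in>\<Lambda>. \<forall>m. m \<notin> \<Lambda> \<longrightarrow> norm (basis_coeff smul e x n) \<ge> norm (basis_coeff smul e x m))}"

text \<open>All admissible choices of the \<open>N\<close>-th greedy approximant of \<open>x\<close>.\<close>

definition greedy_approximants ::
  "('k::real_normed_field \<Rightarrow> 'a \<Rightarrow> 'a::real_normed_vector) \<Rightarrow> (nat \<Rightarrow> 'a) \<Rightarrow> nat \<Rightarrow> 'a \<Rightarrow> 'a set" where
  "greedy_approximants smul e N x =
     (\<lambda>\<Lambda>. \<Sum>n\<in>\<Lambda>. smul (basis_coeff smul e x n) (e n)) ` greedy_sets smul e N x"

definition best_error ::
  "('k \<Rightarrow> 'a \<Rightarrow> 'a::real_normed_vector) \<Rightarrow> (nat \<Rightarrow> 'a) \<Rightarrow> nat \<Rightarrow> 'a \<Rightarrow> real" where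
  "best_error smul e N x =
     Inf {norm (x - (\<Sum>n\<in>\<Lambda>. smul (b n) (e n))) | \<Lambda> b. finite \<Lambda> \<and> card \<Lambda> = N}"

text \<open>
  For a normalised basis the coefficients of \<open>x\<close> tend to \<open>0\<close>, so there are admissible sets, and
  they yield only finitely many approximants: either the sets all lie in one finite set of indices,
  or they all contain the support of \<open>x\<close>.  Hence \<open>Max\<close> below is a genuine maximum.
\<close>

definition greedy_error ::
  "('k::real_normed_field \<Rightarrow> 'a \<Rightarrow> 'a::real_normed_vector) \<Rightarrow> (nat \<Rightarrow> 'a) \<Rightarrow> nat \<Rightarrow> 'a \<Rightarrow> real" where
  "greedy_error smul e N x = Max ((\<lambda>g. norm (x - g)) ` greedy_approximants smul e N x)"

definition ennreal_powr :: "ennreal \<Rightarrow> real \<Rightarrow> ennreal" where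
  "ennreal_powr t p = (if t = top then top else ennreal (enn2real t powr p))"
  \<comment> \<open>only meant for positive exponents\<close>

text \<open>
  The weighted \<open>\<ell>\<^sup>q\<close> expression of an error sequence \<open>s 1, s 2, \<dots>\<close>.  The exponent \<open>q\<close>
  ranges over \<open>(0, \<infinity>]\<close>; in the series the summation index is \<open>N = Suc n\<close>.
\<close>

definition weighted_lq :: "real \<Rightarrow> ennreal \<Rightarrow> (nat \<Rightarrow> real) \<Rightarrow> ennreal" where
  "weighted_lq \<alpha> q s =
     (if q = top then (SUP N\<in>{1..}. ennreal (real N powr \<alpha> * s N))
      else ennreal_powr
             (\<Sum>n. ennreal ((real (Suc n) powr \<alpha> * s (Suc n)) powr enn2real q * (1 / real (Suc n))))
             (1 / enn2real q))"

definition approx_norm ::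
  "('k \<Rightarrow> 'a \<Rightarrow> 'a::real_normed_vector) \<Rightarrow> (nat \<Rightarrow> 'a) \<Rightarrow> real \<Rightarrow> ennreal \<Rightarrow> 'a \<Rightarrow> ennreal" where
  "approx_norm smul e \<alpha> q x = ennreal (norm x) + weighted_lq \<alpha> q (\<lambda>N. best_error smul e N x)"

definition approx_space ::
  "('k \<Rightarrow> 'a \<Rightarrow> 'a::real_normed_vector) \<Rightarrow> (nat \<Rightarrow> 'a) \<Rightarrow> real \<Rightarrow> ennreal \<Rightarrow> 'a set" where
  "approx_space smul e \<alpha> q = {x. approx_norm smul e \<alpha> q x < top}"

definition greedy_norm ::
  "('k::real_normed_field \<Rightarrow> 'a \<Rightarrow> 'a::real_normed_vector) \<Rightarrow> (nat \<Rightarrow> 'a) \<Rightarrow> real \<Rightarrow> ennreal \<Rightarrow> 'a \<Rightarrow> ennreal" where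
  "greedy_norm smul e \<alpha> q x = ennreal (norm x) + weighted_lq \<alpha> q (\<lambda>N. greedy_error smul e N x)"

definition greedy_embeds ::
  "('k::real_normed_field \<Rightarrow> 'a \<Rightarrow> 'a::real_normed_vector) \<Rightarrow> (nat \<Rightarrow> 'a) \<Rightarrow> real \<Rightarrow> ennreal \<Rightarrow> bool" where
  "greedy_embeds smul e \<alpha> q \<longleftrightarrow> (\<exists>C::real. \<forall>x\<in>approx_space smul e \<alpha> q.
     greedy_norm smul e \<alpha> q x \<le> ennreal C * approx_norm smul e \<alpha> q x)"

end

theory Submission
  imports Defs
begin

text \<open>
  Democracy says that the norm of a sum of basis vectors is governed, up to a constant, by the number
  of summands.  In an unconditional basis this is what makes the thresholding of coefficients an
  almost optimal way of choosing \<open>N\<close> terms.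

  All arguments rest on one inequality for unconditional bases (\<open>multiplier_constant\<close>): shrinking
  finitely many coefficients of \<open>x\<close>, and discarding the others, increases the norm at most by a
  factor \<open>K\<close>.  Its core, the uniform boundedness of the projections onto finite sets of coordinates,
  is a case of the open mapping theorem: \<open>sup\<^sub>F \<parallel>P\<^sub>F x\<parallel>\<close> is a finer norm on the same Banach space, and
  Baire's theorem together with a successive approximation shows that it is dominated by the original
  norm.

  Suppose that the basis is democratic.  Let \<open>\<Lambda>\<close> be a greedy set of \<open>x\<close>, and let \<open>p\<close> be any
  competitor with coefficients on a set \<open>\<Gamma>\<close> of the same size.  Then
  \<open>x - P\<^sub>\<Lambda> x = (I - P\<^sub>\<Lambda>\<^sub>\<union>\<^sub>\<Gamma>) (x - p) + P\<^sub>\<Gamma>\<^sub>-\<^sub>\<Lambda> x\<close>.  The first term is controlled by \<open>x - p\<close>.  In the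
  second term no coefficient exceeds in modulus any coefficient of \<open>x\<close> on \<open>\<Lambda> - \<Gamma>\<close>, so that
  democracy lets one exchange \<open>\<Gamma> - \<Lambda>\<close> for \<open>\<Lambda> - \<Gamma>\<close>, where \<open>x\<close> and \<open>x - p\<close> have the same coefficients
  (\<open>democratic_imp_near_best\<close>).  The pointwise estimate of the greedy error by the best error passes
  to the weighted \<open>\<ell>\<^sup>q\<close> expressions by monotonicity and homogeneity, which gives every embedding.

  Conversely, suppose that the embedding holds for one pair \<open>(\<alpha>, q)\<close>.  Write \<open>1\<^sub>A\<close> for the sum of
  the basis vectors with index in \<open>A\<close>.  For disjoint \<open>A\<close> and \<open>B\<close> with \<open>n\<close> and \<open>m\<close> elements, consider
  \<open>x = 1\<^sub>A + 2 1\<^sub>B\<close>.  The greedy algorithm takes the vectors of \<open>B\<close> first, so its error is at least of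
  the order of \<open>\<parallel>1\<^sub>A\<parallel>\<close> for all \<open>N \<le> m\<close>, and the greedy expression is at least of the order of
  \<open>m\<^sup>\<alpha> \<parallel>1\<^sub>A\<parallel>\<close>.  The best approximation can remove \<open>A\<close> first; this bounds the approximation expression
  by a multiple of \<open>n\<^sup>\<alpha> \<parallel>1\<^sub>A\<parallel> + m\<^sup>\<alpha> \<parallel>1\<^sub>B\<parallel>\<close>.  If \<open>k n \<le> m\<close> for a sufficiently large constant \<open>k\<close>, the
  term with \<open>n\<^sup>\<alpha>\<close> can be absorbed, and \<open>\<parallel>1\<^sub>A\<parallel> \<le> C \<parallel>1\<^sub>B\<parallel>\<close> follows (\<open>greedy_embeds_imp_comparison\<close>).
  The restriction \<open>k n \<le> m\<close> is harmless: a set with \<open>m\<close> elements, \<open>m \<ge> k\<close>, splits into at most \<open>2 k\<close>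
  sets with at most \<open>m div k\<close> elements, and smaller sets are compared trivially
  (\<open>comparison_imp_democratic\<close>).
\<close>

section \<open>Weighted \<open>\<ell>\<^sup>q\<close> expressions of step functions\<close>

lemma ennreal_powr_ennreal:
  assumes "0 \<le> r"
  shows "ennreal_powr (ennreal r) p = ennreal (r powr p)"
  using assms by (simp add: ennreal_powr_def)

lemma ennreal_powr_mono:
  assumes "0 \<le> p" "s \<le> t"
  shows "ennreal_powr s p \<le> ennreal_powr t p"
  using assms by (cases s; cases t)
    (auto simp: ennreal_powr_ennreal powr_mono2 top_unique, simp_all add: ennreal_powr_def)

lemma ennreal_powr_cmult:
  assumes "0 < c"
  shows "ennreal_powr (ennreal c * t) p = ennreal (c powr p) * ennreal_powr t p"
proof (cases t)
  case (real r)
  then show ?thesis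
    using assms by (simp add: ennreal_powr_ennreal powr_mult flip: ennreal_mult)
next
  case top
  then show ?thesis
    using assms by (simp add: ennreal_powr_def ennreal_mult_top)
qed

text \<open>
  The sum is at most twice the maximum.  This crude bound covers exponents on both sides of \<open>1\<close>.
\<close>

lemma ennreal_powr_add_le:
  assumes "0 \<le> p"
  shows "ennreal_powr (s + t) p \<le> ennreal (2 powr p) * (ennreal_powr s p + ennreal_powr t p)"
proof -
  have "s + t \<le> ennreal 2 * max s t"
    by (simp add: mult_2 add_mono)
  then have "ennreal_powr (s + t) p \<le> ennreal (2 powr p) * ennreal_powr (max s t) p"
    using ennreal_powr_mono[OF assms] ennreal_powr_cmult[of 2 "max s t" p] by fastforce
  also have "ennreal_powr (max s t) p \<le> ennreal_powr s p + ennreal_powr t p"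
    by (simp add: max_def)
  finally show ?thesis
    by (simp add: mult_left_mono)
qed

lemma weighted_lq_top: "weighted_lq \<alpha> top s = (SUP N\<in>{1..}. ennreal (real N powr \<alpha> * s N))"
  by (simp add: weighted_lq_def)

lemma weighted_lq_finite:
  assumes "q \<noteq> top"
  shows "weighted_lq \<alpha> q s = ennreal_powr (\<Sum>n. ennreal
    ((real (Suc n) powr \<alpha> * s (Suc n)) powr enn2real q * (1 / real (Suc n)))) (1 / enn2real q)"
  using assms by (simp add: weighted_lq_def)

lemma weighted_lq_mono:
  assumes st: "\<And>N. 1 \<le> N \<Longrightarrow> 0 \<le> s N \<and> s N \<le> t N"
  shows "weighted_lq \<alpha> q s \<le> weighted_lq \<alpha> q t"
proof (cases "q = top")
  case True
  then show ?thesis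
    unfolding True weighted_lq_top using st
    by (intro SUP_subset_mono order_refl ennreal_leI mult_left_mono) auto
next
  case False
  show ?thesis
    unfolding weighted_lq_finite[OF False]
    using st by (intro ennreal_powr_mono suminf_le ennreal_leI mult_right_mono powr_mono2 mult_left_mono)
      (auto intro!: mult_nonneg_nonneg)
qed

lemma weighted_lq_cmult:
  assumes q: "0 < q" and c: "0 < c" and s: "\<And>N. 1 \<le> N \<Longrightarrow> 0 \<le> s N"
  shows "weighted_lq \<alpha> q (\<lambda>N. c * s N) = ennreal c * weighted_lq \<alpha> q s"
proof (cases "q = top")
  case True
  have "ennreal (real N powr \<alpha> * (c * s N)) = ennreal c * ennreal (real N powr \<alpha> * s N)" if "1 \<le> N" for N
    using c s[OF that] by (simp add: mult_ac flip: ennreal_mult)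
  then show ?thesis
    unfolding True weighted_lq_top SUP_mult_left_ennreal by (intro SUP_cong) auto
next
  case False
  define r where "r = enn2real q"
  have r: "0 < r"
    using q False by (simp add: r_def enn2real_positive_iff less_top)
  have "ennreal ((real (Suc n) powr \<alpha> * (c * s (Suc n))) powr r * (1 / real (Suc n))) =
      ennreal (c powr r) * ennreal ((real (Suc n) powr \<alpha> * s (Suc n)) powr r * (1 / real (Suc n)))" for n
    by (subst ennreal_mult[symmetric]) (simp_all add: powr_mult mult_ac)
  then have "weighted_lq \<alpha> q (\<lambda>N. c * s N) = ennreal_powr (ennreal (c powr r) *
      (\<Sum>n. ennreal ((real (Suc n) powr \<alpha> * s (Suc n)) powr r * (1 / real (Suc n))))) (1 / r)"
    unfolding weighted_lq_finite[OF False] r_def[symmetric] by (simp only: ennreal_suminf_cmult)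
  also have "\<dots> = ennreal ((c powr r) powr (1 / r)) * weighted_lq \<alpha> q s"
    unfolding weighted_lq_finite[OF False] r_def[symmetric] using c by (intro ennreal_powr_cmult) simp
  finally show ?thesis
    using c r by (simp add: powr_powr)
qed

text \<open>
  For \<open>q < 1\<close> only a quasi-triangle inequality can hold.  Replacing a sum by twice its maximum, once
  inside and once outside the series, gives the factor \<open>2 * 2 powr (1 / q)\<close> for every finite \<open>q\<close>.
\<close>

lemma weighted_lq_add_le:
  assumes q: "0 < q"
  shows "\<exists>Q>0. \<forall>s t. (\<forall>N\<ge>1. 0 \<le> s N \<and> 0 \<le> t N) \<longrightarrow>
    weighted_lq \<alpha> q (\<lambda>N. s N + t N) \<le> ennreal Q * (weighted_lq \<alpha> q s + weighted_lq \<alpha> q t)"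
proof (cases "q = top")
  case True
  have "weighted_lq \<alpha> q (\<lambda>N. s N + t N) \<le> ennreal 1 * (weighted_lq \<alpha> q s + weighted_lq \<alpha> q t)"
    if st: "\<forall>N\<ge>1. 0 \<le> s N \<and> 0 \<le> t N" for s t
  proof -
    have "ennreal (real N powr \<alpha> * (s N + t N)) \<le> weighted_lq \<alpha> top s + weighted_lq \<alpha> top t"
      if "N \<in> {1..}" for N
    proof -
      have "ennreal (real N powr \<alpha> * (s N + t N)) =
          ennreal (real N powr \<alpha> * s N) + ennreal (real N powr \<alpha> * t N)"
        using st that by (simp add: distrib_left)
      also have "\<dots> \<le> weighted_lq \<alpha> top s + weighted_lq \<alpha> top t"
        unfolding weighted_lq_top using that by (intro add_mono SUP_upper)
      finally show ?thesis .
    qed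
    then show ?thesis
      unfolding True by (simp add: weighted_lq_top[of _ "\<lambda>N. s N + t N"] SUP_le_iff)
  qed
  then show ?thesis by (intro exI[of _ 1]) auto
next
  case False
  define r where "r = enn2real q"
  have r: "0 < r"
    using q False by (simp add: r_def enn2real_positive_iff less_top)
  define T where "T s n = ennreal ((real (Suc n) powr \<alpha> * s (Suc n)) powr r * (1 / real (Suc n)))" for s n
  have lq: "weighted_lq \<alpha> q s = ennreal_powr (\<Sum>n. T s n) (1 / r)" for s
    by (simp add: weighted_lq_finite[OF False] T_def r_def)
  have "weighted_lq \<alpha> q (\<lambda>N. s N + t N) \<le>
      ennreal (2 * 2 powr (1 / r)) * (weighted_lq \<alpha> q s + weighted_lq \<alpha> q t)"
    if st: "\<forall>N\<ge>1. 0 \<le> s N \<and> 0 \<le> t N" for s t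
  proof -
    have "T (\<lambda>N. s N + t N) n \<le> ennreal (2 powr r) * (T s n + T t n)" for n
    proof -
      define u where "u = real (Suc n) powr \<alpha>"
      have pos: "0 \<le> u * s (Suc n)" "0 \<le> u * t (Suc n)"
        using st by (auto simp: u_def)
      have "(u * (s (Suc n) + t (Suc n))) powr r \<le> (2 * max (u * s (Suc n)) (u * t (Suc n))) powr r"
        using pos r by (intro powr_mono2) (auto simp: distrib_left)
      also have "\<dots> \<le> 2 powr r * ((u * s (Suc n)) powr r + (u * t (Suc n)) powr r)"
        using pos by (simp add: powr_mult max_def)
      finally have "(u * (s (Suc n) + t (Suc n))) powr r * (1 / real (Suc n)) \<le>
          2 powr r * ((u * s (Suc n)) powr r * (1 / real (Suc n)) + (u * t (Suc n)) powr r * (1 / real (Suc n)))"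
        by (simp add: divide_simps)
      then show ?thesis
        unfolding T_def u_def[symmetric]
        by (subst ennreal_plus[symmetric], simp, simp, subst ennreal_mult[symmetric]) (auto intro!: ennreal_leI)
    qed
    then have "(\<Sum>n. T (\<lambda>N. s N + t N) n) \<le> (\<Sum>n. ennreal (2 powr r) * (T s n + T t n))"
      by (intro suminf_le) auto
    also have "\<dots> = ennreal (2 powr r) * ((\<Sum>n. T s n) + (\<Sum>n. T t n))"
      by (simp add: suminf_add)
    finally have "weighted_lq \<alpha> q (\<lambda>N. s N + t N) \<le>
        ennreal_powr (ennreal (2 powr r) * ((\<Sum>n. T s n) + (\<Sum>n. T t n))) (1 / r)"
      unfolding lq using r by (intro ennreal_powr_mono) auto
    also have "\<dots> = ennreal 2 * ennreal_powr ((\<Sum>n. T s n) + (\<Sum>n. T t n)) (1 / r)"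
      using r by (subst ennreal_powr_cmult) (auto simp: powr_powr)
    also have "\<dots> \<le> ennreal 2 * (ennreal (2 powr (1 / r)) * (weighted_lq \<alpha> q s + weighted_lq \<alpha> q t))"
      unfolding lq using r by (intro mult_left_mono ennreal_powr_add_le) auto
    finally show ?thesis
      by (simp add: ennreal_mult mult.assoc)
  qed
  then show ?thesis by (intro exI[of _ "2 * 2 powr (1 / r)"]) auto
qed

text \<open>
  The mean value theorem compares \<open>N powr (p - 1)\<close> with an increment of \<open>N powr p\<close>, whose sums
  telescope.  The case \<open>n = 0\<close> is left out because \<open>powr\<close> need not be differentiable at \<open>0\<close>.
\<close>

lemma powr_increment_mvt:
  fixes p :: real
  assumes "1 \<le> n"
  obtains \<xi> where "real n < \<xi>" "\<xi> < real (Suc n)"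
    "real (Suc n) powr p - real n powr p = p * \<xi> powr (p - 1)"
proof -
  have "\<exists>\<xi>. real n < \<xi> \<and> \<xi> < real (Suc n) \<and>
      real (Suc n) powr p - real n powr p = (real (Suc n) - real n) * (p * \<xi> powr (p - 1))"
    using assms by (intro MVT2) (auto intro!: has_real_derivative_powr)
  then show ?thesis
    using that by auto
qed

text \<open>
  One bound comes from comparing every summand with the last one, the other from telescoping; which is
  the upper and which the lower one depends on whether \<open>p - 1\<close> is negative.
\<close>

lemma sum_powr_bounds:
  fixes p :: real
  assumes p: "0 < p"
  shows "\<exists>a>0. \<exists>b>0. \<forall>m. a * real m powr p \<le> (\<Sum>n<m. real (Suc n) powr (p - 1)) \<and>
     (\<Sum>n<m. real (Suc n) powr (p - 1)) \<le> b * real m powr p"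
proof -
  have telescope: "(\<Sum>n<m. real (Suc n) powr p - real n powr p) = real m powr p" for m
    by (simp add: sum_lessThan_telescope[of "\<lambda>n. real n powr p"] del: of_nat_Suc)
  have const: "(\<Sum>n<m. real m powr (p - 1)) = real m powr p" for m :: nat
    by (cases "m = 0") (simp_all add: powr_diff)
  show ?thesis
  proof (cases "p < 1")
    case True
    have "p * real (Suc n) powr (p - 1) \<le> real (Suc n) powr p - real n powr p" for n
    proof (cases "n = 0")
      case False
      then obtain \<xi> where "real n < \<xi>" "\<xi> < real (Suc n)"
        and eq: "real (Suc n) powr p - real n powr p = p * \<xi> powr (p - 1)"
        using powr_increment_mvt[of n p] by auto
      then have "real (Suc n) powr (p - 1) \<le> \<xi> powr (p - 1)"
        using True False by (intro powr_mono2') auto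
      then show ?thesis using p unfolding eq by simp
    qed (use True in simp)
    then have "p * (\<Sum>n<m. real (Suc n) powr (p - 1)) \<le> real m powr p" for m
      unfolding telescope[of m, symmetric] sum_distrib_left by (intro sum_mono)
    then have "(\<Sum>n<m. real (Suc n) powr (p - 1)) \<le> (1 / p) * real m powr p" for m
      using p by (simp add: field_simps)
    moreover have "1 * real m powr p \<le> (\<Sum>n<m. real (Suc n) powr (p - 1))" for m
      unfolding const[of m, symmetric] mult_1 using True by (intro sum_mono powr_mono2') auto
    ultimately show ?thesis
      using p by (intro exI[of _ 1] exI[of _ "1 / p"] conjI) auto
  next
    case False
    have "real (Suc n) powr p - real n powr p \<le> p * real (Suc n) powr (p - 1)" for n
    proof (cases "n = 0")
      case n: False
      then obtain \<xi> where "real n < \<xi>" "\<xi> < real (Suc n)"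
        and eq: "real (Suc n) powr p - real n powr p = p * \<xi> powr (p - 1)"
        using powr_increment_mvt[of n p] by auto
      then have "\<xi> powr (p - 1) \<le> real (Suc n) powr (p - 1)"
        using False n by (intro powr_mono2) auto
      then show ?thesis using p unfolding eq by simp
    qed (use False in simp)
    then have "real m powr p \<le> p * (\<Sum>n<m. real (Suc n) powr (p - 1))" for m
      unfolding telescope[of m, symmetric] sum_distrib_left by (intro sum_mono)
    then have "(1 / p) * real m powr p \<le> (\<Sum>n<m. real (Suc n) powr (p - 1))" for m
      using p by (simp add: field_simps)
    moreover have "(\<Sum>n<m. real (Suc n) powr (p - 1)) \<le> 1 * real m powr p" for m
      unfolding const[of m, symmetric] mult_1 using False by (intro sum_mono powr_mono2) auto
    ultimately show ?thesis
      using p by (intro exI[of _ 1] exI[of _ "1 / p"] conjI) auto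
  qed
qed

text \<open>
  The weights make the indicator function of \<open>{1..m}\<close> grow like \<open>m powr \<alpha>\<close>, whatever \<open>q\<close> is:
  for finite \<open>q\<close> the series is the power sum with exponent \<open>\<alpha> * q - 1\<close>.  Taking \<open>b \<ge> 1\<close> makes the upper bound
  large enough to absorb the summand \<open>norm x\<close> of the approximation norm as well.
\<close>

lemma weighted_lq_step_bounds:
  assumes \<alpha>: "0 < \<alpha>" and q: "0 < q"
  shows "\<exists>a>0. \<exists>b\<ge>1. \<forall>m\<ge>1. ennreal (a * real m powr \<alpha>) \<le> weighted_lq \<alpha> q (\<lambda>N. if N \<le> m then 1 else 0) \<and>
     weighted_lq \<alpha> q (\<lambda>N. if N \<le> m then 1 else 0) \<le> ennreal (b * real m powr \<alpha>)"
proof (cases "q = top")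
  case True
  have "weighted_lq \<alpha> q (\<lambda>N. if N \<le> m then 1 else 0) = ennreal (real m powr \<alpha>)" if "1 \<le> m" for m
  proof (rule antisym)
    show "weighted_lq \<alpha> q (\<lambda>N. if N \<le> m then 1 else 0) \<le> ennreal (real m powr \<alpha>)"
      unfolding True weighted_lq_top using \<alpha> by (intro SUP_least ennreal_leI) (auto intro!: powr_mono2)
    have "ennreal (real m powr \<alpha> * (if m \<le> m then 1 else 0)) \<le> weighted_lq \<alpha> q (\<lambda>N. if N \<le> m then 1 else 0)"
      unfolding True weighted_lq_top using that by (intro SUP_upper) auto
    then show "ennreal (real m powr \<alpha>) \<le> weighted_lq \<alpha> q (\<lambda>N. if N \<le> m then 1 else 0)" by simp
  qed
  then show ?thesis by (intro exI[of _ 1]) auto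
next
  case False
  define r where "r = enn2real q"
  have r: "0 < r"
    using q False by (simp add: r_def enn2real_positive_iff less_top)
  define S where "S m = (\<Sum>n<m. real (Suc n) powr (\<alpha> * r - 1))" for m
  have S0: "0 \<le> S m" for m
    by (auto simp: S_def intro: sum_nonneg)
  have lq: "weighted_lq \<alpha> q (\<lambda>N. if N \<le> m then 1 else 0) = ennreal (S m powr (1 / r))" for m
  proof -
    have eq: "ennreal ((real (Suc n) powr \<alpha> * (if Suc n \<le> m then 1 else 0)) powr r * (1 / real (Suc n))) =
        (if n < m then ennreal (real (Suc n) powr (\<alpha> * r - 1)) else 0)" for n
      using r by (auto simp: powr_powr powr_diff simp del: of_nat_Suc)
    have "(\<Sum>n. ennreal ((real (Suc n) powr \<alpha> * (if Suc n \<le> m then 1 else 0)) powr r * (1 / real (Suc n)))) =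
        (\<Sum>n<m. ennreal (real (Suc n) powr (\<alpha> * r - 1)))"
      unfolding eq by (subst suminf_finite[of "{..<m}"]) (auto simp del: of_nat_Suc)
    also have "\<dots> = ennreal (S m)"
      by (simp add: S_def sum_ennreal del: of_nat_Suc)
    finally show ?thesis
      unfolding weighted_lq_finite[OF False] r_def[symmetric] by (simp add: ennreal_powr_ennreal S0)
  qed
  obtain a b where a: "0 < a" and b: "0 < b"
    and bounds: "\<And>m. a * real m powr (\<alpha> * r) \<le> S m \<and> S m \<le> b * real m powr (\<alpha> * r)"
    using sum_powr_bounds[of "\<alpha> * r"] \<alpha> r unfolding S_def by auto
  have root: "(c * real m powr (\<alpha> * r)) powr (1 / r) = c powr (1 / r) * real m powr \<alpha>" if "0 < c" for c m
    using that r by (simp add: powr_mult powr_powr)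
  have lower: "a powr (1 / r) * real m powr \<alpha> \<le> S m powr (1 / r)" for m
    unfolding root[OF a, symmetric] using bounds[of m] a r by (intro powr_mono2) auto
  have "S m powr (1 / r) \<le> b powr (1 / r) * real m powr \<alpha>" for m
    unfolding root[OF b, symmetric] using bounds[of m] r S0 by (intro powr_mono2) auto
  then have upper: "S m powr (1 / r) \<le> max 1 (b powr (1 / r)) * real m powr \<alpha>" for m
    by (rule order_trans) (auto intro: mult_right_mono)
  show ?thesis
    unfolding lq using a lower upper
    by (intro exI[of _ "a powr (1 / r)"] exI[of _ "max 1 (b powr (1 / r))"] conjI) (auto intro!: ennreal_leI)
qed

section \<open>Unconditional bases and their multipliers\<close>

text \<open>
  Baire's theorem, applied to the closures of the sets.
\<close>

lemma Baire_cover_by_sequence: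
  fixes V :: "nat \<Rightarrow> 'a::banach set"
  assumes "(\<Union>k. V k) = UNIV"
  obtains k x r where "0 < r" "ball x r \<subseteq> closure (V k)"
proof -
  have "\<exists>k. interior (closure (V k)) \<noteq> {}"
  proof (rule ccontr)
    assume *: "\<not> ?thesis"
    have "Met_TC.mtopology interior_of \<Union>(range (\<lambda>k. closure (V k))) = {}"
    proof (rule Met_TC.metric_Baire_category_alt)
      show "Met_TC.mcomplete TYPE('a)"
        by (simp add: complete_UNIV)
    qed (use * in auto)
    moreover have "\<Union>(range (\<lambda>k. closure (V k))) = UNIV"
      using assms closure_subset by blast
    ultimately show False by simp
  qed
  then obtain k x where "x \<in> interior (closure (V k))" by blast
  then obtain r where "0 < r" "ball x r \<subseteq> closure (V k)"
    by (auto simp: mem_interior)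
  then show ?thesis using that by blast
qed

text \<open>
  The norm is a convex function of each \<open>t n\<close> separately, so on the cube it is largest at a vertex, where
  every coordinate is \<open>0\<close> or \<open>1\<close>.  The offset \<open>y\<close> collects the coordinates that the induction has fixed.
\<close>

lemma norm_sum_scaled_le_vertices:
  fixes v :: "'i \<Rightarrow> 'a::real_normed_vector"
  assumes "finite F" and "\<And>n. n \<in> F \<Longrightarrow> 0 \<le> t n \<and> t n \<le> 1"
    and "\<And>G. G \<subseteq> F \<Longrightarrow> norm (y + (\<Sum>n\<in>G. v n)) \<le> M"
  shows "norm (y + (\<Sum>n\<in>F. t n *\<^sub>R v n)) \<le> M"
  using assms
proof (induction F arbitrary: y rule: finite_induct)
  case empty
  then show ?case by simp
next
  case (insert m F)
  have 0: "norm (y + (\<Sum>n\<in>F. t n *\<^sub>R v n)) \<le> M"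
    using insert.prems by (intro insert.IH) auto
  have 1: "norm ((y + v m) + (\<Sum>n\<in>F. t n *\<^sub>R v n)) \<le> M"
  proof (rule insert.IH)
    fix G assume "G \<subseteq> F"
    then have "finite G" "m \<notin> G" "insert m G \<subseteq> insert m F"
      using insert.hyps finite_subset by auto
    then show "norm ((y + v m) + (\<Sum>n\<in>G. v n)) \<le> M"
      using insert.prems(2)[of "insert m G"] by (simp add: add.assoc)
  qed (use insert.prems in auto)
  have t: "0 \<le> t m" "t m \<le> 1" using insert.prems by auto
  have "y + (\<Sum>n\<in>insert m F. t n *\<^sub>R v n) =
      (1 - t m) *\<^sub>R (y + (\<Sum>n\<in>F. t n *\<^sub>R v n)) + t m *\<^sub>R ((y + v m) + (\<Sum>n\<in>F. t n *\<^sub>R v n))"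
    using insert.hyps by (simp add: algebra_simps)
  also have "norm \<dots> \<le> (1 - t m) * norm (y + (\<Sum>n\<in>F. t n *\<^sub>R v n)) +
      t m * norm ((y + v m) + (\<Sum>n\<in>F. t n *\<^sub>R v n))"
    using t by (intro order_trans[OF norm_triangle_ineq]) simp
  also have "\<dots> \<le> M"
    using t by (intro convex_bound_le 0 1) auto
  finally show ?case .
qed

locale normalised_unconditional_basis = banach_over smul
  for smul :: "'k::{real_normed_field, euclidean_space} \<Rightarrow> 'a::banach \<Rightarrow> 'a" +
  fixes e :: "nat \<Rightarrow> 'a"
  assumes norm_e: "norm (e n) = 1"
    and unconditional: "unconditional_basis smul e"
begin

abbreviation coeff :: "'a \<Rightarrow> nat \<Rightarrow> 'k" where
  "coeff x n \<equiv> basis_coeff smul e x n"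

definition proj :: "nat set \<Rightarrow> 'a \<Rightarrow> 'a" where
  "proj F x = (\<Sum>n\<in>F. smul (coeff x n) (e n))"

text \<open>
  This is what allows a convergent series of scalars to be multiplied into a vector term by term.
\<close>

lemma bounded_linear_smul_left: "bounded_linear (\<lambda>c. smul c y)"
proof (rule bounded_linear_intro)
  fix r :: real and c :: 'k
  have "smul (r *\<^sub>R c) y = smul (of_real r) (smul c y)"
    by (simp add: scaleR_conv_of_real)
  also have "\<dots> = r *\<^sub>R smul c y"
    by (rule scale_of_real)
  finally show "smul (r *\<^sub>R c) y = r *\<^sub>R smul c y" .
qed (auto simp: norm_scale scale_left_distrib)

lemma norm_smul_e [simp]: "norm (smul c (e n)) = norm c"
  by (simp add: norm_scale norm_e)

lemma ex1_coeff: "\<exists>!a. (\<lambda>n. smul (a n) (e n)) sums x"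
  using unconditional by (simp add: unconditional_basis_def schauder_basis_def)

lemma sums_coeff: "(\<lambda>n. smul (coeff x n) (e n)) sums x"
  using theI'[OF ex1_coeff[of x]] by (simp add: basis_coeff_def)

lemma coeff_eqI:
  assumes "(\<lambda>n. smul (a n) (e n)) sums x"
  shows "basis_coeff smul e x = a"
  using assms ex1_coeff[of x] sums_coeff[of x] by blast

lemma has_sum_coeff: "((\<lambda>n. smul (coeff x n) (e n)) has_sum x) UNIV"
  using unconditional sums_coeff[of x] by (simp add: unconditional_basis_def)

lemma coeff_add: "coeff (x + y) n = coeff x n + coeff y n"
proof -
  have "basis_coeff smul e (x + y) = (\<lambda>n. coeff x n + coeff y n)"
    by (rule coeff_eqI) (use sums_add[OF sums_coeff[of x] sums_coeff[of y]]
        in \<open>simp add: scale_left_distrib\<close>)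
  then show ?thesis by simp
qed

lemma coeff_diff: "coeff (x - y) n = coeff x n - coeff y n"
proof -
  have "basis_coeff smul e (x - y) = (\<lambda>n. coeff x n - coeff y n)"
    by (rule coeff_eqI) (use sums_diff[OF sums_coeff[of x] sums_coeff[of y]]
        in \<open>simp add: scale_left_diff_distrib\<close>)
  then show ?thesis by simp
qed

lemma coeff_scaleR: "coeff (r *\<^sub>R x) n = r *\<^sub>R coeff x n"
proof -
  have "(\<lambda>n. r *\<^sub>R smul (coeff x n) (e n)) sums (r *\<^sub>R x)"
    by (intro sums_scaleR_right sums_coeff)
  then have "basis_coeff smul e (r *\<^sub>R x) = (\<lambda>n. r *\<^sub>R coeff x n)"
    by (intro coeff_eqI) (simp add: linear_cmul[OF bounded_linear.linear[OF bounded_linear_smul_left]])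
  then show ?thesis by simp
qed

lemma coeff_sum:
  assumes "finite F"
  shows "coeff (\<Sum>n\<in>F. smul (b n) (e n)) m = (if m \<in> F then b m else 0)"
proof -
  have "(\<lambda>n. if n \<in> F then smul (b n) (e n) else 0) sums (\<Sum>n\<in>F. smul (b n) (e n))"
    by (rule sums_If_finite_set[OF assms])
  also have "(\<lambda>n. if n \<in> F then smul (b n) (e n) else 0) =
      (\<lambda>n. smul (if n \<in> F then b n else 0) (e n))"
    by auto
  finally show ?thesis
    using coeff_eqI by auto
qed

lemma coeff_tendsto_0: "(\<lambda>n. coeff x n) \<longlonglongrightarrow> 0"
proof -
  have "(\<lambda>n. smul (coeff x n) (e n)) \<longlonglongrightarrow> 0"
    using sums_coeff[of x] sums_summable summable_LIMSEQ_zero by blast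
  then have "(\<lambda>n. norm (coeff x n)) \<longlonglongrightarrow> 0"
    using tendsto_norm_zero by fastforce
  then show ?thesis by (rule tendsto_norm_zero_cancel)
qed

lemma proj_diff: "proj F (x - y) = proj F x - proj F y"
  by (simp add: proj_def coeff_diff scale_left_diff_distrib sum_subtractf)

lemma proj_scaleR: "proj F (r *\<^sub>R x) = r *\<^sub>R proj F x"
  by (simp add: proj_def coeff_scaleR scaleR_sum_right
      linear_cmul[OF bounded_linear.linear[OF bounded_linear_smul_left]])

lemma proj_lessThan_tendsto: "(\<lambda>N. proj {..<N} x) \<longlonglongrightarrow> x"
  using sums_coeff[of x] by (simp add: sums_def proj_def)

text \<open>
  A finite set \<open>F0\<close> captures the sum up to \<open>1\<close>.  Any \<open>F\<close> differs from a superset of \<open>F0\<close> only by part of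
  \<open>F0\<close>, and there are finitely many such parts.
\<close>

lemma bounded_proj_pointwise: "\<exists>M. \<forall>F. finite F \<longrightarrow> norm (proj F x) \<le> M"
proof -
  have "((\<lambda>F. proj F x) \<longlongrightarrow> x) (finite_subsets_at_top UNIV)"
    using has_sum_coeff[of x] by (simp add: has_sum_def proj_def)
  then have "\<forall>\<^sub>F F in finite_subsets_at_top UNIV. dist (proj F x) x < 1"
    by (rule tendstoD) simp
  then obtain F0 where F0: "finite F0" "\<And>F. finite F \<Longrightarrow> F0 \<subseteq> F \<Longrightarrow> dist (proj F x) x < 1"
    by (auto simp: eventually_finite_subsets_at_top)
  have "norm (proj F x) \<le> 1 + norm x + (\<Sum>n\<in>F0. norm (coeff x n))" if F: "finite F" for F
  proof -
    have "proj (F \<union> (F0 - F)) x = proj F x + proj (F0 - F) x"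
      unfolding proj_def using F F0(1) by (intro sum.union_disjoint) auto
    then have eq: "proj F x = proj (F \<union> F0) x - proj (F0 - F) x"
      by simp
    have "norm (proj (F \<union> F0) x) \<le> 1 + norm x"
      using F0(2)[of "F \<union> F0"] F F0(1) norm_triangle_ineq2[of "proj (F \<union> F0) x" x]
      by (auto simp: dist_norm)
    moreover have "norm (proj (F0 - F) x) \<le> (\<Sum>n\<in>F0 - F. norm (coeff x n))"
      unfolding proj_def by (rule order_trans[OF norm_sum]) simp
    moreover have "\<dots> \<le> (\<Sum>n\<in>F0. norm (coeff x n))"
      using F0(1) by (intro sum_mono2) auto
    ultimately show ?thesis
      unfolding eq using norm_triangle_ineq4[of "proj (F \<union> F0) x" "proj (F0 - F) x"] by linarith
  qed
  then show ?thesis by blast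
qed

text \<open>
  By Baire's theorem the vectors whose projections are bounded by some \<open>k\<close> are dense in a ball.
  Differences of such vectors are then dense in a ball around \<open>0\<close>, and scaling reaches every vector.
  As continuity of the coefficients is not known at this point, the density cannot be removed by passing
  to a limit.
\<close>

lemma approximation_with_bounded_proj:
  "\<exists>L\<ge>0. \<forall>y. \<forall>\<epsilon>>0. \<exists>z. norm (y - z) < \<epsilon> \<and> (\<forall>F. finite F \<longrightarrow> norm (proj F z) \<le> L * norm y)"
proof -
  define V where "V k = {x. \<forall>F. finite F \<longrightarrow> norm (proj F x) \<le> real k}" for k :: nat
  have "(\<Union>k. V k) = UNIV"
  proof -
    have "\<exists>k. x \<in> V k" for x
    proof -
      obtain M where M: "\<And>F. finite F \<Longrightarrow> norm (proj F x) \<le> M"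
        using bounded_proj_pointwise by blast
      obtain k :: nat where "M \<le> real k" using real_arch_simple by blast
      with M show ?thesis unfolding V_def by (auto intro: order_trans)
    qed
    then show ?thesis by auto
  qed
  then obtain k x0 r where r: "0 < r" and ball: "ball x0 r \<subseteq> closure (V k)"
    by (rule Baire_cover_by_sequence)
  have near: "\<exists>z. norm (y - z) < \<epsilon> \<and> (\<forall>F. finite F \<longrightarrow> norm (proj F z) \<le> 2 * real k)"
    if y: "norm y < r" and \<epsilon>: "0 < \<epsilon>" for y \<epsilon>
  proof -
    have "x0 + y \<in> closure (V k)" "x0 \<in> closure (V k)"
      using ball y r by (auto simp: dist_norm subset_iff)
    then obtain u v where u: "u \<in> V k" "dist u (x0 + y) < \<epsilon> / 2" and v: "v \<in> V k" "dist v x0 < \<epsilon> / 2"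
      using \<epsilon> by (meson closure_approachable half_gt_zero)
    have "norm (y - (u - v)) < \<epsilon>"
    proof -
      have "norm ((v - x0) - (u - (x0 + y))) < \<epsilon> / 2 + \<epsilon> / 2"
        using u(2) v(2) norm_triangle_ineq4[of "v - x0" "u - (x0 + y)"] unfolding dist_norm by linarith
      moreover have "y - (u - v) = (v - x0) - (u - (x0 + y))" by simp
      ultimately show ?thesis by (simp only: field_sum_of_halves)
    qed
    moreover have "norm (proj F (u - v)) \<le> 2 * real k" if "finite F" for F
    proof -
      have "norm (proj F u) \<le> k" "norm (proj F v) \<le> k"
        using u(1) v(1) that by (auto simp: V_def)
      then show ?thesis
        using norm_triangle_ineq4[of "proj F u" "proj F v"] by (simp add: proj_diff)
    qed
    ultimately show ?thesis by blast
  qed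
  have "\<exists>z. norm (y - z) < \<epsilon> \<and> (\<forall>F. finite F \<longrightarrow> norm (proj F z) \<le> (4 * real k / r) * norm y)"
    if \<epsilon>: "0 < \<epsilon>" for y \<epsilon>
  proof (cases "y = 0")
    case True
    have "coeff 0 n = 0" for n
      using coeff_diff[of 0 0 n] by simp
    then have "proj F 0 = 0" for F
      by (simp add: proj_def)
    then show ?thesis using True \<epsilon> by (intro exI[of _ 0]) auto
  next
    case False
    define t where "t = r / (2 * norm y)"
    have t: "0 < t" using False r by (simp add: t_def)
    have "norm (t *\<^sub>R y) < r" using t False r by (simp add: t_def)
    then obtain z where z: "norm (t *\<^sub>R y - z) < t * \<epsilon>"
      "\<And>F. finite F \<Longrightarrow> norm (proj F z) \<le> 2 * real k"
      using near[of "t *\<^sub>R y" "t * \<epsilon>"] t \<epsilon> by auto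
    have "norm (y - inverse t *\<^sub>R z) < \<epsilon>"
    proof -
      have "y - inverse t *\<^sub>R z = inverse t *\<^sub>R (t *\<^sub>R y - z)"
        using t by (simp add: scaleR_right_diff_distrib)
      then have "norm (y - inverse t *\<^sub>R z) = inverse t * norm (t *\<^sub>R y - z)"
        using t by simp
      also have "\<dots> < inverse t * (t * \<epsilon>)"
        using t by (intro mult_strict_left_mono z(1)) simp
      also have "\<dots> = \<epsilon>"
        using t by simp
      finally show ?thesis .
    qed
    moreover have "norm (proj F (inverse t *\<^sub>R z)) \<le> (4 * real k / r) * norm y" if "finite F" for F
    proof -
      have "norm (proj F (inverse t *\<^sub>R z)) = inverse t * norm (proj F z)"
        using t by (simp add: proj_scaleR)
      also have "\<dots> \<le> inverse t * (2 * real k)"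
        using z(2)[OF that] t by (intro mult_left_mono) auto
      also have "\<dots> = (4 * real k / r) * norm y"
        using False r by (simp add: t_def field_simps)
      finally show ?thesis .
    qed
    ultimately show ?thesis by blast
  qed
  then show ?thesis using r by (intro exI[of _ "4 * real k / r"]) auto
qed

text \<open>
  The proof of the open mapping theorem, for the norm \<open>sup\<^sub>F \<parallel>P\<^sub>F x\<parallel>\<close>.  Successive approximation writes
  \<open>x\<close> as a series of vectors \<open>z j\<close> whose projections decrease geometrically.  Their coefficients add up to
  scalars \<open>a n\<close>; dominated convergence shows that these expand \<open>x\<close>, and uniqueness of the expansion
  identifies them with the coefficients of \<open>x\<close>.
\<close>

lemma suppression_constant:
  "\<exists>K\<ge>0. \<forall>x F. finite F \<longrightarrow> norm (proj F x) \<le> K * norm x"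
proof -
  obtain L where L: "0 \<le> L" and "\<forall>y. \<forall>\<epsilon>>0. \<exists>z. norm (y - z) < \<epsilon> \<and>
      (\<forall>F. finite F \<longrightarrow> norm (proj F z) \<le> L * norm y)"
    using approximation_with_bounded_proj by blast
  then obtain Z where Z: "norm (y - Z y \<epsilon>) < \<epsilon>" "finite F \<Longrightarrow> norm (proj F (Z y \<epsilon>)) \<le> L * norm y"
    if "0 < \<epsilon>" for y \<epsilon> F
    by metis
  have "norm (proj F x) \<le> 2 * L * norm x" if F: "finite F" and "x \<noteq> 0" for x F
  proof -
    \<comment> \<open>\<open>r j\<close> is what remains of \<open>x\<close> after \<open>j\<close> corrections; its norm is at most \<open>norm x / 2 ^ j\<close>.\<close>
    define r where "r = rec_nat x (\<lambda>j y. y - Z y (norm x / 2 ^ Suc j))"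
    define z where "z j = r j - r (Suc j)" for j
    define M where "M j = L * norm x * (1 / 2) ^ j" for j :: nat
    have pos: "0 < norm x / 2 ^ j" for j :: nat
      using \<open>x \<noteq> 0\<close> by simp
    have r0: "r 0 = x" and r_Suc: "r (Suc j) = r j - Z (r j) (norm x / 2 ^ Suc j)" for j
      by (simp_all add: r_def)
    have norm_r: "norm (r j) \<le> norm x / 2 ^ j" for j
      using Z(1)[OF pos, of "r (j - 1)" j] by (cases j) (auto simp: r0 r_Suc less_imp_le)
    have proj_z: "norm (proj G (z j)) \<le> M j" if "finite G" for G j
    proof -
      have "norm (proj G (z j)) \<le> L * norm (r j)"
        using Z(2)[OF pos that, of "r j" "Suc j"] by (simp add: z_def r_Suc)
      also have "\<dots> \<le> L * (norm x / 2 ^ j)"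
        by (intro mult_left_mono norm_r L)
      finally show ?thesis by (simp add: M_def power_divide)
    qed
    have M_sums: "M sums (2 * L * norm x)"
      using sums_mult[OF geometric_sums[of "1 / 2 :: real"], of "L * norm x"]
      by (simp add: M_def[abs_def] mult_ac)
    then have M_summable: "summable M" by (rule sums_summable)
    have z_sums: "z sums x"
    proof -
      have "(\<lambda>j. norm x / 2 ^ j) \<longlonglongrightarrow> 0"
        by (rule LIMSEQ_divide_realpow_zero) simp
      then have "r \<longlonglongrightarrow> 0"
        by (rule Lim_null_comparison[rotated]) (simp add: norm_r)
      then show ?thesis
        using telescope_sums'[of r 0] by (simp add: z_def[abs_def] r0)
    qed
    define a where "a n = (\<Sum>j. coeff (z j) n)" for n
    have "summable (\<lambda>j. coeff (z j) n)" for n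
      using proj_z[of "{n}"] by (intro summable_comparison_test'[OF M_summable, of 0]) (simp add: proj_def)
    then have "(\<lambda>j. smul (coeff (z j) n) (e n)) sums smul (a n) (e n)" for n
      unfolding a_def by (intro bounded_linear.sums[OF bounded_linear_smul_left] summable_sums)
    then have S: "(\<lambda>j. proj G (z j)) sums (\<Sum>n\<in>G. smul (a n) (e n))" for G
      unfolding proj_def by (intro sums_sum)
    have norm_S: "norm (\<Sum>n\<in>G. smul (a n) (e n)) \<le> 2 * L * norm x" if "finite G" for G
      using norm_suminf_le[OF proj_z[OF that] M_summable] S[of G] M_sums by (simp add: sums_iff)
    \<comment> \<open>The initial projections of \<open>z j\<close> converge to \<open>z j\<close>, so their bound is inherited.\<close>
    have norm_z: "norm (z j) \<le> M j" for j
      by (rule LIMSEQ_le_const2[OF tendsto_norm[OF proj_lessThan_tendsto]]) (simp add: proj_z)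
    have diff_le: "norm (proj {..<N} (z j) - z j) \<le> 2 * M j" for N j
      using norm_triangle_ineq4[of "proj {..<N} (z j)" "z j"] proj_z[of "{..<N}" j] norm_z[of j] by simp
    have diff_summable: "summable (\<lambda>j. norm (proj {..<N} (z j) - z j))" for N
      by (rule summable_comparison_test'[OF summable_mult[OF M_summable, of 2], of 0]) (simp add: diff_le)
    have diff_lim: "(\<lambda>N. norm (proj {..<N} (z j) - z j)) \<longlonglongrightarrow> 0" for j
      using tendsto_norm[OF tendsto_diff[OF proj_lessThan_tendsto[of "z j"] tendsto_const[of "z j"]]] by simp
    have "(\<lambda>N. \<Sum>j. norm (proj {..<N} (z j) - z j)) \<longlonglongrightarrow> (\<Sum>j. 0)"
    proof (rule tannerys_theorem[THEN conjunct2, THEN conjunct2])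
      show "\<forall>\<^sub>F (j, N) in sequentially \<times>\<^sub>F sequentially.
          norm (norm (proj {..<N} (z j) - z j)) \<le> 2 * M j"
        by (intro always_eventually) (simp add: diff_le)
      show "summable (\<lambda>j. 2 * M j)"
        by (rule summable_mult[OF M_summable])
    qed (rule diff_lim, rule trivial_limit_sequentially)
    then have lim0: "(\<lambda>N. \<Sum>j. norm (proj {..<N} (z j) - z j)) \<longlonglongrightarrow> 0"
      by simp
    have S_diff: "norm ((\<Sum>n<N. smul (a n) (e n)) - x) \<le> (\<Sum>j. norm (proj {..<N} (z j) - z j))" for N
    proof -
      have "(\<Sum>n<N. smul (a n) (e n)) - x = (\<Sum>j. proj {..<N} (z j) - z j)"
        by (rule sums_unique[OF sums_diff[OF S[of "{..<N}"] z_sums]])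
      then show ?thesis
        using summable_norm[OF diff_summable[of N]] by simp
    qed
    have "(\<lambda>N. (\<Sum>n<N. smul (a n) (e n)) - x) \<longlonglongrightarrow> 0"
      by (rule Lim_null_comparison[OF _ lim0]) (rule always_eventually, rule allI, rule S_diff)
    then have "(\<lambda>n. smul (a n) (e n)) sums x"
      unfolding sums_def by (rule LIM_zero_cancel)
    then have "basis_coeff smul e x = a"
      by (rule coeff_eqI)
    then show ?thesis
      using norm_S[OF F] by (simp add: proj_def)
  qed
  moreover have "norm (proj F 0) \<le> 2 * L * norm (0 :: 'a)" for F
    using proj_diff[of F 0 0] by simp
  ultimately have "norm (proj F x) \<le> 2 * L * norm x" if "finite F" for x F
    using that by (cases "x = 0") auto
  then show ?thesis
    using L by (intro exI[of _ "2 * L"]) simp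
qed


text \<open>
  Suppressing coordinates corresponds to multipliers with values \<open>0\<close> and \<open>1\<close>; convexity extends the bound
  to values in \<open>[0, 1]\<close>, positive and negative parts extend it to \<open>[-1, 1]\<close>, and coordinates with
  respect to the finite basis of the scalar field extend it to the unit ball.
\<close>

lemma multiplier_constant:
  "\<exists>K>0. \<forall>x F b. finite F \<longrightarrow> (\<forall>n\<in>F. norm (b n) \<le> norm (coeff x n)) \<longrightarrow>
     norm (\<Sum>n\<in>F. smul (b n) (e n)) \<le> K * norm x"
proof -
  obtain K where K: "0 \<le> K" "\<And>x F. finite F \<Longrightarrow> norm (proj F x) \<le> K * norm x"
    using suppression_constant by blast
  have real01: "norm (\<Sum>n\<in>F. t n *\<^sub>R smul (coeff x n) (e n)) \<le> K * norm x"
    if F: "finite F" and t: "\<And>n. n \<in> F \<Longrightarrow> 0 \<le> t n \<and> t n \<le> 1" for x F and t :: "nat \<Rightarrow> real"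
    using norm_sum_scaled_le_vertices[OF F, where t = t and y = 0 and v = "\<lambda>n. smul (coeff x n) (e n)"] t K(2)
    by (simp add: proj_def finite_subset[OF _ F])
  have real: "norm (\<Sum>n\<in>F. t n *\<^sub>R smul (coeff x n) (e n)) \<le> 2 * K * norm x"
    if F: "finite F" and t: "\<And>n. n \<in> F \<Longrightarrow> \<bar>t n\<bar> \<le> 1" for x F and t :: "nat \<Rightarrow> real"
  proof -
    have "(\<Sum>n\<in>F. t n *\<^sub>R smul (coeff x n) (e n)) =
        (\<Sum>n\<in>F. max (t n) 0 *\<^sub>R smul (coeff x n) (e n)) - (\<Sum>n\<in>F. max (- t n) 0 *\<^sub>R smul (coeff x n) (e n))"
      by (auto simp: sum_subtractf[symmetric] scaleR_left_diff_distrib[symmetric] max_def intro!: sum.cong)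
    moreover have "norm (\<Sum>n\<in>F. max (t n) 0 *\<^sub>R smul (coeff x n) (e n)) \<le> K * norm x"
      using t by (intro real01[OF F]) (simp add: abs_le_iff)
    moreover have "norm (\<Sum>n\<in>F. max (- t n) 0 *\<^sub>R smul (coeff x n) (e n)) \<le> K * norm x"
      using t by (intro real01[OF F]) (simp add: abs_le_iff)
    ultimately show ?thesis
      using norm_triangle_ineq4[of "\<Sum>n\<in>F. max (t n) 0 *\<^sub>R smul (coeff x n) (e n)"
          "\<Sum>n\<in>F. max (- t n) 0 *\<^sub>R smul (coeff x n) (e n)"] by simp
  qed
  define D where "D = real DIM('k)"
  have "norm (\<Sum>n\<in>F. smul (b n) (e n)) \<le> (D * (2 * K) + 1) * norm x"
    if F: "finite F" and b: "\<And>n. n \<in> F \<Longrightarrow> norm (b n) \<le> norm (coeff x n)" for x F b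
  proof -
    \<comment> \<open>Where the coefficient of \<open>x\<close> vanishes, so does \<open>b n\<close>, and any multiplier serves.\<close>
    define l where "l n = (if coeff x n = 0 then 0 else b n / coeff x n)" for n
    have l: "norm (l n) \<le> 1" "l n * coeff x n = b n" if "n \<in> F" for n
      using b[OF that] by (auto simp: l_def norm_divide divide_le_eq)
    have expand: "smul (b n) (e n) = (\<Sum>i\<in>Basis. smul i ((l n \<bullet> i) *\<^sub>R smul (coeff x n) (e n)))" if "n \<in> F" for n
    proof -
      have "b n = (\<Sum>i\<in>Basis. (l n \<bullet> i) *\<^sub>R i) * coeff x n"
        using l(2)[OF that] by (simp add: euclidean_representation)
      also have "\<dots> = (\<Sum>i\<in>Basis. i * (of_real (l n \<bullet> i) * coeff x n))"
        unfolding sum_distrib_right by (intro sum.cong) (simp_all add: scaleR_conv_of_real mult_ac)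
      finally have "smul (b n) (e n) = (\<Sum>i\<in>Basis. smul i (smul (of_real (l n \<bullet> i)) (smul (coeff x n) (e n))))"
        by (simp add: scale_sum_left)
      then show ?thesis
        by (simp only: scale_of_real)
    qed
    have "(\<Sum>n\<in>F. smul (b n) (e n)) = (\<Sum>n\<in>F. \<Sum>i\<in>Basis. smul i ((l n \<bullet> i) *\<^sub>R smul (coeff x n) (e n)))"
      using expand by (intro sum.cong) auto
    also have "\<dots> = (\<Sum>i\<in>Basis. smul i (\<Sum>n\<in>F. (l n \<bullet> i) *\<^sub>R smul (coeff x n) (e n)))"
      by (subst sum.swap) (simp only: scale_sum_right)
    also have "norm \<dots> \<le> (\<Sum>i\<in>(Basis :: 'k set). 2 * K * norm x)"
    proof (rule sum_norm_le)
      fix i :: 'k assume i: "i \<in> Basis"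
      have "\<bar>l n \<bullet> i\<bar> \<le> 1" if "n \<in> F" for n
        using Basis_le_norm[OF i, of "l n"] l(1)[OF that] by linarith
      then show "norm (smul i (\<Sum>n\<in>F. (l n \<bullet> i) *\<^sub>R smul (coeff x n) (e n))) \<le> 2 * K * norm x"
        using real[OF F, of "\<lambda>n. l n \<bullet> i" x] i by (simp add: norm_scale)
    qed
    finally have "norm (\<Sum>n\<in>F. smul (b n) (e n)) \<le> D * (2 * K) * norm x"
      by (simp add: D_def)
    also have "\<dots> \<le> (D * (2 * K) + 1) * norm x"
      by (intro mult_right_mono) simp_all
    finally show ?thesis .
  qed
  moreover have "0 < D * (2 * K) + 1"
    using K(1) by (intro add_nonneg_pos mult_nonneg_nonneg) (simp_all add: D_def)
  ultimately show ?thesis by (intro exI[of _ "D * (2 * K) + 1"]) simp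
qed

end

section \<open>Greedy approximants and error functionals\<close>

lemma ex_superset_card:
  fixes F :: "nat set"
  assumes "finite F" "card F \<le> N"
  obtains G where "F \<subseteq> G" "finite G" "card G = N"
proof -
  have "infinite (UNIV - F)"
    using assms(1) by (simp add: Diff_infinite_finite)
  then obtain H where "finite H" "card H = N - card F" "H \<subseteq> UNIV - F"
    using infinite_arbitrarily_large by blast
  moreover from this have "card (F \<union> H) = card F + card H"
    using assms by (intro card_Un_disjoint) auto
  ultimately show ?thesis
    using assms by (intro that[of "F \<union> H"]) auto
qed

text \<open>
  Cut off pieces of \<open>n\<close> elements until nothing is left, and apply the triangle inequality.
\<close>

lemma norm_sum_le_by_pieces:
  fixes f :: "'i \<Rightarrow> 'a::real_normed_vector"
  assumes "finite A" "card A \<le> j * n"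
    and "\<And>G. G \<subseteq> A \<Longrightarrow> card G \<le> n \<Longrightarrow> norm (sum f G) \<le> M"
  shows "norm (sum f A) \<le> real j * M"
  using assms
proof (induction j arbitrary: A)
  case 0
  then show ?case by simp
next
  case (Suc j)
  obtain G where G: "G \<subseteq> A" "card G = min n (card A)"
    by (rule obtain_subset_with_card_n[of "min n (card A)" A]) simp
  have "finite G" using G Suc.prems(1) finite_subset by blast
  then have "norm (sum f (A - G)) \<le> real j * M"
    using G Suc.prems by (intro Suc.IH) (auto simp: card_Diff_subset)
  moreover have "norm (sum f G) \<le> M"
    using G by (intro Suc.prems(3)) auto
  moreover have "sum f A = sum f (A - G) + sum f G"
    using G(1) Suc.prems(1) by (rule sum.subset_diff)
  ultimately show ?case
    using norm_triangle_ineq[of "sum f (A - G)" "sum f G"] by (simp add: distrib_right)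
qed

context normalised_unconditional_basis
begin

text \<open>
  The vectors \<open>e n\<close> have norm \<open>1\<close>, so the coefficients of a convergent expansion tend to \<open>0\<close>.
\<close>

lemma finite_large_coeffs:
  assumes "0 < t"
  shows "finite {n. t \<le> norm (coeff x n)}"
proof -
  have "\<forall>\<^sub>F n in sequentially. norm (coeff x n) < t"
    using tendstoD[OF coeff_tendsto_0 assms, of x] by simp
  then obtain m where "\<And>n. m \<le> n \<Longrightarrow> norm (coeff x n) < t"
    by (auto simp: eventually_sequentially)
  then have "{n. t \<le> norm (coeff x n)} \<subseteq> {..<m}"
    by (auto simp: not_le[symmetric])
  then show ?thesis using finite_subset by blast
qed

text \<open>
  A greedy set is enlarged by an index of a largest remaining coefficient, which exists because only
  finitely many coefficients exceed a given positive bound.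
\<close>

lemma greedy_sets_nonempty: "greedy_sets smul e N x \<noteq> {}"
proof (induction N)
  case 0
  have "{} \<in> greedy_sets smul e 0 x" by (simp add: greedy_sets_def)
  then show ?case by blast
next
  case (Suc N)
  then obtain \<Lambda> where \<Lambda>: "finite \<Lambda>" "card \<Lambda> = N"
    "\<And>n m. n \<in> \<Lambda> \<Longrightarrow> m \<notin> \<Lambda> \<Longrightarrow> norm (coeff x m) \<le> norm (coeff x n)"
    by (auto simp: greedy_sets_def)
  have "\<exists>n. n \<notin> \<Lambda> \<and> (\<forall>m. m \<notin> \<Lambda> \<longrightarrow> norm (coeff x m) \<le> norm (coeff x n))"
  proof (cases "\<exists>l. l \<notin> \<Lambda> \<and> coeff x l \<noteq> 0")
    case True
    then obtain l where l: "l \<notin> \<Lambda>" "coeff x l \<noteq> 0" by blast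
    define S where "S = {n. norm (coeff x l) \<le> norm (coeff x n)} - \<Lambda>"
    have S: "finite S" "l \<in> S"
      using l finite_large_coeffs[of "norm (coeff x l)" x] by (auto simp: S_def)
    then have "Max ((\<lambda>m. norm (coeff x m)) ` S) \<in> (\<lambda>m. norm (coeff x m)) ` S"
      by (intro Max_in) auto
    then obtain n where n: "n \<in> S" "Max ((\<lambda>m. norm (coeff x m)) ` S) = norm (coeff x n)"
      by (rule imageE)
    have max: "norm (coeff x m) \<le> norm (coeff x n)" if "m \<in> S" for m
      unfolding n(2)[symmetric] using S(1) that by (intro Max_ge) auto
    have "norm (coeff x m) \<le> norm (coeff x n)" if "m \<notin> \<Lambda>" for m
      using max[of m] max[OF S(2)] that by (cases "m \<in> S") (auto simp: S_def)
    then show ?thesis using n(1) by (auto simp: S_def)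
  next
    case False
    moreover obtain l where "l \<notin> \<Lambda>" using \<Lambda>(1) ex_new_if_finite by blast
    ultimately show ?thesis by (intro exI[of _ l]) auto
  qed
  then obtain n where "n \<notin> \<Lambda>" "\<And>m. m \<notin> \<Lambda> \<Longrightarrow> norm (coeff x m) \<le> norm (coeff x n)" by blast
  then have "insert n \<Lambda> \<in> greedy_sets smul e (Suc N) x"
    using \<Lambda> by (auto simp: greedy_sets_def)
  then show ?case by blast
qed

lemma greedy_approximants_eq: "greedy_approximants smul e N x = (\<lambda>\<Lambda>. proj \<Lambda> x) ` greedy_sets smul e N x"
  by (simp add: greedy_approximants_def proj_def)

lemma proj_eq_self:
  assumes "finite F" "\<And>n. n \<notin> F \<Longrightarrow> coeff x n = 0"
  shows "proj F x = x"
proof -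
  have "(\<lambda>n. smul (coeff x n) (e n)) sums proj F x"
    unfolding proj_def using assms by (intro sums_finite) auto
  then show ?thesis using sums_coeff sums_unique2 by blast
qed

text \<open>
  Ties may produce infinitely many greedy sets, but only when they contain the whole support of \<open>x\<close>, and
  then they all yield \<open>x\<close> itself.  Otherwise the least modulus of the coefficients on one greedy set is a
  number \<open>t > 0\<close>, and all greedy sets of that size lie in the finite set of the indices whose coefficients
  have modulus at least \<open>t\<close>.
\<close>

lemma finite_greedy_approximants:
  assumes "1 \<le> N"
  shows "finite (greedy_approximants smul e N x)"
proof -
  obtain \<Lambda>0 where "\<Lambda>0 \<in> greedy_sets smul e N x"
    using greedy_sets_nonempty by blast
  then have \<Lambda>0: "finite \<Lambda>0" "card \<Lambda>0 = N"
    "\<And>n m. n \<in> \<Lambda>0 \<Longrightarrow> m \<notin> \<Lambda>0 \<Longrightarrow> norm (coeff x m) \<le> norm (coeff x n)"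
    by (auto simp: greedy_sets_def)
  show ?thesis
  proof (cases "\<exists>n\<in>\<Lambda>0. coeff x n = 0")
    case True
    then obtain n0 where n0: "n0 \<in> \<Lambda>0" "coeff x n0 = 0" by blast
    have supp: "l \<in> \<Lambda>0" if "coeff x l \<noteq> 0" for l
      using \<Lambda>0(3)[OF n0(1), of l] n0(2) that by auto
    have "proj \<Lambda> x = x" if "\<Lambda> \<in> greedy_sets smul e N x" for \<Lambda>
    proof (rule proj_eq_self)
      have \<Lambda>: "finite \<Lambda>" "card \<Lambda> = N"
        "\<And>n m. n \<in> \<Lambda> \<Longrightarrow> m \<notin> \<Lambda> \<Longrightarrow> norm (coeff x m) \<le> norm (coeff x n)"
        using that by (auto simp: greedy_sets_def)
      then show "finite \<Lambda>" by simp
      fix m assume m: "m \<notin> \<Lambda>"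
      show "coeff x m = 0"
      proof (rule ccontr)
        assume nz: "coeff x m \<noteq> 0"
        have "l \<in> \<Lambda>0" if "l \<in> \<Lambda>" for l
          using \<Lambda>(3)[OF that m] nz by (intro supp) auto
        then have "insert m \<Lambda> \<subseteq> \<Lambda>0"
          using supp[OF nz] by blast
        then have "card (insert m \<Lambda>) \<le> N"
          using \<Lambda>0 card_mono by blast
        then show False using \<Lambda> m by simp
      qed
    qed
    then have "greedy_approximants smul e N x \<subseteq> {x}"
      by (auto simp: greedy_approximants_eq)
    then show ?thesis using finite_subset by blast
  next
    case False
    define t where "t = Min ((\<lambda>n. norm (coeff x n)) ` \<Lambda>0)"
    have "\<Lambda>0 \<noteq> {}" using \<Lambda>0(2) assms by auto
    then have t: "0 < t" "\<And>n. n \<in> \<Lambda>0 \<Longrightarrow> t \<le> norm (coeff x n)"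
      using False \<Lambda>0(1) by (auto simp: t_def)
    have "\<Lambda> \<subseteq> {n. t \<le> norm (coeff x n)}" if "\<Lambda> \<in> greedy_sets smul e N x" for \<Lambda>
    proof (rule ccontr)
      have \<Lambda>: "finite \<Lambda>" "card \<Lambda> = N"
        "\<And>n m. n \<in> \<Lambda> \<Longrightarrow> m \<notin> \<Lambda> \<Longrightarrow> norm (coeff x m) \<le> norm (coeff x n)"
        using that by (auto simp: greedy_sets_def)
      assume "\<not> ?thesis"
      then obtain l where "l \<in> \<Lambda>" "l \<notin> {n. t \<le> norm (coeff x n)}" by blast
      then have l: "l \<in> \<Lambda>" "norm (coeff x l) < t" by simp_all
      have "n \<in> \<Lambda>" if "n \<in> \<Lambda>0" for n
      proof (rule ccontr)
        assume "n \<notin> \<Lambda>"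
        then show False using \<Lambda>(3)[OF l(1), of n] t(2)[OF that] l(2) by simp
      qed
      then have "\<Lambda>0 \<subseteq> \<Lambda>" by blast
      moreover have "l \<notin> \<Lambda>0" using t(2)[of l] l(2) by auto
      ultimately have "\<Lambda>0 \<subset> \<Lambda>" using l(1) by blast
      then have "card \<Lambda>0 < card \<Lambda>" by (rule psubset_card_mono[OF \<Lambda>(1)])
      then show False using \<Lambda>(2) \<Lambda>0(2) by simp
    qed
    then have "greedy_sets smul e N x \<subseteq> Pow {n. t \<le> norm (coeff x n)}" by blast
    then have "finite (greedy_sets smul e N x)"
      using finite_large_coeffs[OF t(1)] finite_subset by blast
    then show ?thesis by (simp add: greedy_approximants_eq)
  qed
qed

lemma greedy_error_attained:
  assumes "1 \<le> N"
  shows "\<exists>g\<in>greedy_approximants smul e N x. greedy_error smul e N x = norm (x - g)"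
proof -
  have "greedy_error smul e N x \<in> (\<lambda>g. norm (x - g)) ` greedy_approximants smul e N x"
    unfolding greedy_error_def using finite_greedy_approximants[OF assms] greedy_sets_nonempty
    by (intro Max_in) (auto simp: greedy_approximants_eq)
  then show ?thesis by auto
qed

lemma norm_diff_le_greedy_error:
  assumes "1 \<le> N" "g \<in> greedy_approximants smul e N x"
  shows "norm (x - g) \<le> greedy_error smul e N x"
  unfolding greedy_error_def using finite_greedy_approximants[OF assms(1)] assms(2)
  by (intro Max_ge) auto

text \<open>
  Sets with fewer than \<open>N\<close> elements may compete as well: they are padded with zero coefficients.
\<close>

lemma best_error_le:
  assumes "finite F" "card F \<le> N"
  shows "best_error smul e N x \<le> norm (x - (\<Sum>n\<in>F. smul (b n) (e n)))"
proof -
  obtain G where G: "F \<subseteq> G" "finite G" "card G = N"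
    using ex_superset_card[OF assms] .
  have "(\<Sum>n\<in>F. smul (b n) (e n)) = (\<Sum>n\<in>G. smul (if n \<in> F then b n else 0) (e n))"
    using G by (intro sum.mono_neutral_cong_left) auto
  then show ?thesis
    unfolding best_error_def using G
    by (intro cInf_lower bdd_belowI[of _ 0]) auto
qed

lemma best_error_greatest:
  assumes "\<And>F b. finite F \<Longrightarrow> card F = N \<Longrightarrow> c \<le> norm (x - (\<Sum>n\<in>F. smul (b n) (e n)))"
  shows "c \<le> best_error smul e N x"
  unfolding best_error_def
proof (rule cInf_greatest)
  have "norm (x - (\<Sum>n\<in>{..<N}. smul 0 (e n))) \<in>
      {norm (x - (\<Sum>n\<in>F. smul (b n) (e n))) |F b. finite F \<and> card F = N}"
    by (intro CollectI exI[of _ "{..<N}"] exI[of _ "\<lambda>_. 0"]) auto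
  then show "{norm (x - (\<Sum>n\<in>F. smul (b n) (e n))) |F b. finite F \<and> card F = N} \<noteq> {}" by blast
qed (use assms in auto)

lemma best_error_nonneg: "0 \<le> best_error smul e N x"
  by (rule best_error_greatest) simp

lemma scaleR_sum_e: "r *\<^sub>R (\<Sum>n\<in>A. e n) = (\<Sum>n\<in>A. smul (of_real r) (e n))"
  by (simp only: scaleR_sum_right scale_of_real)

lemma coeff_sum_e:
  assumes "finite A"
  shows "coeff (\<Sum>n\<in>A. e n) m = (if m \<in> A then 1 else 0)"
  using coeff_sum[OF assms, of "\<lambda>_. 1" m] by simp

section \<open>Near-best greedy approximation in democratic bases\<close>

text \<open>
  The error of a greedy set \<open>\<Lambda>\<close> against a competitor \<open>p\<close> supported on \<open>\<Gamma>\<close> splits into the part outside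
  \<open>\<Lambda> \<union> \<Gamma>\<close>, where \<open>x\<close> and \<open>x - p\<close> agree, and the part on \<open>\<Gamma> - \<Lambda>\<close>.  The coefficients of the latter
  lie below those on \<open>\<Lambda> - \<Gamma>\<close>, so it is compared with a vector of constant coefficients on \<open>\<Gamma> - \<Lambda>\<close>, by
  democracy with a vector of the same constant coefficients on \<open>\<Lambda> - \<Gamma>\<close>, and finally with \<open>x - p\<close>.
\<close>

lemma democratic_imp_near_best:
  assumes "democratic e"
  shows "\<exists>C\<ge>1. \<forall>x N. \<forall>g\<in>greedy_approximants smul e N x. norm (x - g) \<le> C * best_error smul e N x"
proof -
  obtain D0 where D0: "\<And>A B. finite A \<Longrightarrow> finite B \<Longrightarrow> card A = card B \<Longrightarrow>
      norm (\<Sum>n\<in>A. e n) \<le> D0 * norm (\<Sum>n\<in>B. e n)"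
    using assms unfolding democratic_def by blast
  define D where "D = max 0 D0"
  have D: "0 \<le> D" "norm (\<Sum>n\<in>A. e n) \<le> D * norm (\<Sum>n\<in>B. e n)"
    if "finite A" "finite B" "card A = card B" for A B
    using D0[OF that] mult_right_mono[of D0 D "norm (\<Sum>n\<in>B. e n)"] by (auto simp: D_def)
  have "0 \<le> D" by (simp add: D_def)
  obtain K where K: "0 < K" "\<And>x F b. finite F \<Longrightarrow> (\<And>n. n \<in> F \<Longrightarrow> norm (b n) \<le> norm (coeff x n)) \<Longrightarrow>
      norm (\<Sum>n\<in>F. smul (b n) (e n)) \<le> K * norm x"
    using multiplier_constant by metis
  define C where "C = 1 + K + K * D * K"
  have "norm (x - proj \<Lambda> x) \<le> C * norm (x - (\<Sum>n\<in>\<Gamma>. smul (b n) (e n)))"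
    if \<Lambda>: "\<Lambda> \<in> greedy_sets smul e N x" and \<Gamma>: "finite \<Gamma>" "card \<Gamma> = N" for x N \<Lambda> \<Gamma> b
  proof -
    have fin: "finite \<Lambda>" "card \<Lambda> = N"
      and gr: "\<And>n m. n \<in> \<Lambda> \<Longrightarrow> m \<notin> \<Lambda> \<Longrightarrow> norm (coeff x m) \<le> norm (coeff x n)"
      using \<Lambda> by (auto simp: greedy_sets_def)
    define p where "p = (\<Sum>n\<in>\<Gamma>. smul (b n) (e n))"
    define w where "w = x - p"
    have coeff_p: "coeff p n = 0" if "n \<notin> \<Gamma>" for n
      using coeff_sum[OF \<Gamma>(1), of b n] that by (simp add: p_def)
    have "proj (\<Lambda> \<union> \<Gamma>) p = p"
      using fin \<Gamma> coeff_p by (intro proj_eq_self) auto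
    moreover have "proj (\<Lambda> \<union> (\<Gamma> - \<Lambda>)) x = proj \<Lambda> x + proj (\<Gamma> - \<Lambda>) x"
      unfolding proj_def using fin \<Gamma> by (intro sum.union_disjoint) auto
    ultimately have split: "x - proj \<Lambda> x = (w - proj (\<Lambda> \<union> \<Gamma>) w) + proj (\<Gamma> - \<Lambda>) x"
      by (simp add: w_def proj_diff)
    have "norm (proj (\<Lambda> \<union> \<Gamma>) w) \<le> K * norm w"
      unfolding proj_def using fin \<Gamma> by (intro K(2)) auto
    then have first: "norm (w - proj (\<Lambda> \<union> \<Gamma>) w) \<le> (1 + K) * norm w"
      using norm_triangle_ineq4[of w "proj (\<Lambda> \<union> \<Gamma>) w"] by (simp add: distrib_right)
    have second: "norm (proj (\<Gamma> - \<Lambda>) x) \<le> K * D * K * norm w"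
    proof (cases "\<Gamma> - \<Lambda> = {}")
      case True
      then have "proj (\<Gamma> - \<Lambda>) x = 0" by (simp only: proj_def sum.empty)
      then show ?thesis using K(1) \<open>0 \<le> D\<close> by simp
    next
      case False
      define t where "t = Max ((\<lambda>n. norm (coeff x n)) ` (\<Gamma> - \<Lambda>))"
      have t_ge: "norm (coeff x n) \<le> t" if "n \<in> \<Gamma> - \<Lambda>" for n
        unfolding t_def using \<Gamma> that by (intro Max_ge) auto
      have "t \<in> (\<lambda>n. norm (coeff x n)) ` (\<Gamma> - \<Lambda>)"
        unfolding t_def using \<Gamma> False by (intro Max_in) auto
      then obtain m where m: "m \<in> \<Gamma> - \<Lambda>" "t = norm (coeff x m)" by auto
      have "0 \<le> t" using m by simp
      have "card (\<Gamma> - \<Lambda>) = card (\<Lambda> - \<Gamma>)"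
        using fin \<Gamma> by (simp add: card_Diff_subset_Int Int_commute)
      then have dem: "norm (\<Sum>n\<in>\<Gamma> - \<Lambda>. e n) \<le> D * norm (\<Sum>n\<in>\<Lambda> - \<Gamma>. e n)"
        using fin \<Gamma> by (intro D) auto
      have "norm (proj (\<Gamma> - \<Lambda>) x) \<le> K * norm (t *\<^sub>R (\<Sum>n\<in>\<Gamma> - \<Lambda>. e n))"
        unfolding proj_def scaleR_sum_e
        using \<Gamma> t_ge \<open>0 \<le> t\<close> by (intro K(2)) (auto simp: coeff_sum)
      also have "\<dots> \<le> K * (t * (D * norm (\<Sum>n\<in>\<Lambda> - \<Gamma>. e n)))"
        using \<open>0 \<le> t\<close> dem K(1) by (auto intro!: mult_left_mono)
      also have "\<dots> = K * D * norm (t *\<^sub>R (\<Sum>n\<in>\<Lambda> - \<Gamma>. e n))"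
        using \<open>0 \<le> t\<close> by simp
      also have "norm (t *\<^sub>R (\<Sum>n\<in>\<Lambda> - \<Gamma>. e n)) \<le> K * norm w"
        unfolding scaleR_sum_e
      proof (rule K(2))
        fix n assume n: "n \<in> \<Lambda> - \<Gamma>"
        then have "coeff w n = coeff x n"
          by (simp add: w_def coeff_diff coeff_p)
        then show "norm (of_real t :: 'k) \<le> norm (coeff w n)"
          using gr[of n m] n m by simp
      qed (use fin in auto)
      finally show ?thesis
        using K(1) \<open>0 \<le> D\<close> by (simp add: mult.assoc mult_left_mono)
    qed
    show ?thesis
      using first second norm_triangle_ineq[of "w - proj (\<Lambda> \<union> \<Gamma>) w" "proj (\<Gamma> - \<Lambda>) x"]
      unfolding split unfolding w_def p_def C_def by (simp add: distrib_right)
  qed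
  note main = this
  have C: "1 \<le> C" using K(1) \<open>0 \<le> D\<close> by (simp add: C_def)
  have "norm (x - g) \<le> C * best_error smul e N x" if g: "g \<in> greedy_approximants smul e N x" for x N g
  proof -
    obtain \<Lambda> where \<Lambda>: "\<Lambda> \<in> greedy_sets smul e N x" "g = proj \<Lambda> x"
      using g by (auto simp: greedy_approximants_eq)
    have "norm (x - g) / C \<le> best_error smul e N x"
      using C main[OF \<Lambda>(1)] by (intro best_error_greatest) (simp add: \<Lambda>(2) divide_le_eq mult.commute)
    then show ?thesis using C by (simp add: divide_le_eq mult.commute)
  qed
  then show ?thesis using C by blast
qed

lemma near_best_imp_greedy_embeds:
  assumes near: "\<And>x N g. 1 \<le> N \<Longrightarrow> g \<in> greedy_approximants smul e N x \<Longrightarrow>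
      norm (x - g) \<le> C * best_error smul e N x"
    and q: "0 < q"
  shows "greedy_embeds smul e \<alpha> q"
proof -
  define C' where "C' = max 1 C"
  have "greedy_norm smul e \<alpha> q x \<le> ennreal C' * approx_norm smul e \<alpha> q x" for x
  proof -
    have "0 \<le> greedy_error smul e N x \<and> greedy_error smul e N x \<le> C' * best_error smul e N x" if N: "1 \<le> N" for N
    proof -
      obtain g where g: "g \<in> greedy_approximants smul e N x" "greedy_error smul e N x = norm (x - g)"
        using greedy_error_attained[OF N] by blast
      have "C * best_error smul e N x \<le> C' * best_error smul e N x"
        by (intro mult_right_mono best_error_nonneg) (simp add: C'_def)
      then show ?thesis using near[OF N g(1)] g(2) by simp
    qed
    then have "weighted_lq \<alpha> q (\<lambda>N. greedy_error smul e N x) \<le> weighted_lq \<alpha> q (\<lambda>N. C' * best_error smul e N x)"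
      by (intro weighted_lq_mono) auto
    also have "\<dots> = ennreal C' * weighted_lq \<alpha> q (\<lambda>N. best_error smul e N x)"
      using q by (intro weighted_lq_cmult) (auto simp: C'_def best_error_nonneg)
    finally have "weighted_lq \<alpha> q (\<lambda>N. greedy_error smul e N x) \<le> \<dots>" .
    moreover have "ennreal 1 * ennreal (norm x) \<le> ennreal C' * ennreal (norm x)"
      by (intro mult_right_mono ennreal_leI) (auto simp: C'_def)
    ultimately show ?thesis
      unfolding greedy_norm_def approx_norm_def by (simp add: distrib_left add_mono)
  qed
  then show ?thesis unfolding greedy_embeds_def by blast
qed

section \<open>Democracy from a single embedding\<close>

text \<open>
  The test vector is \<open>x = 1\<^sub>A + 2 1\<^sub>B\<close>; the coefficient \<open>2\<close> forces the greedy sets into \<open>B\<close>.  Its best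
  errors lie below a sum of two step functions, and its greedy errors above one.  The length of the steps
  enters the \<open>\<ell>\<^sup>q\<close> expressions as a power \<open>\<alpha>\<close>, so that a long greedy step outweighs the short step of height
  \<open>\<parallel>1\<^sub>A\<parallel>\<close> in the best error as soon as \<open>B\<close> is sufficiently larger than \<open>A\<close>.
\<close>

lemma greedy_embeds_imp_comparison:
  assumes \<alpha>: "0 < \<alpha>" and q: "0 < q" and emb: "greedy_embeds smul e \<alpha> q"
  shows "\<exists>k\<ge>1. \<exists>C\<ge>0. \<forall>A B. finite A \<longrightarrow> finite B \<longrightarrow> A \<inter> B = {} \<longrightarrow> k * card A \<le> card B \<longrightarrow>
     norm (\<Sum>n\<in>A. e n) \<le> C * norm (\<Sum>n\<in>B. e n)"
proof -
  obtain C0 where C0: "\<And>x. x \<in> approx_space smul e \<alpha> q \<Longrightarrow>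
      greedy_norm smul e \<alpha> q x \<le> ennreal C0 * approx_norm smul e \<alpha> q x"
    using emb unfolding greedy_embeds_def by blast
  define C where "C = max 1 C0"
  have C: "1 \<le> C" by (simp add: C_def)
  obtain K where K: "0 < K" "\<And>x F b. finite F \<Longrightarrow> (\<And>n. n \<in> F \<Longrightarrow> norm (b n) \<le> norm (coeff x n)) \<Longrightarrow>
      norm (\<Sum>n\<in>F. smul (b n) (e n)) \<le> K * norm x"
    using multiplier_constant by metis
  obtain Q where Q: "0 < Q" "\<And>s t. (\<And>N. 1 \<le> N \<Longrightarrow> 0 \<le> s N \<and> 0 \<le> t N) \<Longrightarrow>
      weighted_lq \<alpha> q (\<lambda>N. s N + t N) \<le> ennreal Q * (weighted_lq \<alpha> q s + weighted_lq \<alpha> q t)"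
    using weighted_lq_add_le[OF q] by metis
  define step where "step m N = (if N \<le> m then 1 else 0 :: real)" for m N :: nat
  obtain a b where a: "0 < a" and b: "1 \<le> b"
    and lower: "\<And>m. 1 \<le> m \<Longrightarrow> ennreal (a * real m powr \<alpha>) \<le> weighted_lq \<alpha> q (step m)"
    and upper: "\<And>m. 1 \<le> m \<Longrightarrow> weighted_lq \<alpha> q (step m) \<le> ennreal (b * real m powr \<alpha>)"
    using weighted_lq_step_bounds[OF \<alpha> q] unfolding step_def[abs_def] by metis
  define E where "E = K * (C * (1 + Q) * b)"
  have E: "0 < E" using K(1) C Q(1) b by (simp add: E_def)
  \<comment> \<open>With this choice of \<open>k\<close> the contribution of the short step is at most half of the lower bound.\<close>
  obtain k :: nat where k: "max 1 ((2 * E / a) powr (1 / \<alpha>)) \<le> real k"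
    using real_arch_simple by blast
  have k1: "1 \<le> k" using k by simp
  have "((2 * E / a) powr (1 / \<alpha>)) powr \<alpha> \<le> real k powr \<alpha>"
    using k \<alpha> by (intro powr_mono2) auto
  then have kE: "E \<le> a / 2 * real k powr \<alpha>"
    using \<alpha> E a by (simp add: powr_powr field_simps)
  have "norm (\<Sum>n\<in>A. e n) \<le> (4 * E * 2 powr \<alpha> / a) * norm (\<Sum>n\<in>B. e n)"
    if A: "finite A" and B: "finite B" and AB: "A \<inter> B = {}" and card: "k * card A \<le> card B" and "A \<noteq> {}" for A B
  proof -
    define n where "n = card A"
    define m where "m = card B"
    define u where "u = norm (\<Sum>n\<in>A. e n)"
    define v where "v = norm (\<Sum>n\<in>B. e n)"
    have n: "1 \<le> n" using \<open>A \<noteq> {}\<close> A by (simp add: n_def Suc_le_eq card_gt_0_iff)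
    have "1 * n \<le> k * n" using k1 by (rule mult_le_mono1)
    then have nm: "n \<le> m" using card unfolding n_def m_def by linarith
    have m: "1 \<le> m" using n nm by simp
    then have "B \<noteq> {}" by (auto simp: m_def)
    have nonzero: "(\<Sum>n\<in>S. e n) \<noteq> 0" if S: "finite S" "S \<noteq> {}" for S
    proof
      assume *: "(\<Sum>n\<in>S. e n) = 0"
      obtain i where "i \<in> S" using S by blast
      then show False using coeff_sum_e[OF S(1), of i] coeff_diff[of 0 0 i] * by simp
    qed
    have u: "0 < u" using nonzero[OF A \<open>A \<noteq> {}\<close>] by (simp add: u_def)
    have v: "0 < v" using nonzero[OF B \<open>B \<noteq> {}\<close>] by (simp add: v_def)
    define x where "x = (\<Sum>n\<in>A. e n) + 2 *\<^sub>R (\<Sum>n\<in>B. e n)"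
    have coeff_x: "coeff x i = (if i \<in> A then 1 else if i \<in> B then 2 else 0)" for i
      using AB by (auto simp: x_def coeff_add coeff_scaleR coeff_sum_e A B scaleR_conv_of_real)
    have norm_x: "norm x \<le> u + 2 * v"
      unfolding x_def u_def v_def by (rule order_trans[OF norm_triangle_ineq]) simp
    \<comment> \<open>The competitors are \<open>0\<close>, the part of \<open>x\<close> on \<open>A\<close>, and \<open>x\<close> itself.\<close>
    have best: "best_error smul e N x \<le> u * step n N + 2 * v * step (2 * m) N" for N
    proof -
      consider "N \<le> n" | "n < N" "N \<le> 2 * m" | "2 * m < N" by linarith
      then show ?thesis
      proof cases
        case 1
        then show ?thesis
          using best_error_le[of "{}" N x "\<lambda>_. 0"] norm_x nm by (simp add: step_def)
      next
        case 2
        have "best_error smul e N x \<le> 2 * v"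
          using best_error_le[of A N x "\<lambda>_. 1"] A 2 by (simp add: n_def x_def v_def)
        then show ?thesis
          using 2 u by (simp add: step_def)
      next
        case 3
        have "card (A \<union> B) \<le> N"
          using card_Un_le[of A B] nm 3 by (simp add: n_def m_def)
        moreover have "proj (A \<union> B) x = x"
          using A B by (intro proj_eq_self) (auto simp: coeff_x)
        ultimately have "best_error smul e N x \<le> 0"
          using best_error_le[of "A \<union> B" N x "basis_coeff smul e x"] A B by (simp add: proj_def)
        then show ?thesis
          using u v by (simp add: step_def)
      qed
    qed
    have greedy: "u / K * step m N \<le> greedy_error smul e N x" if N: "1 \<le> N" for N
    proof (cases "N \<le> m")
      case True
      then obtain \<Lambda> where \<Lambda>: "\<Lambda> \<subseteq> B" "card \<Lambda> = N" "finite \<Lambda>"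
        using obtain_subset_with_card_n[of N B] by (auto simp: m_def)
      have "\<Lambda> \<in> greedy_sets smul e N x"
        using \<Lambda> AB by (auto simp: greedy_sets_def coeff_x)
      then have g: "proj \<Lambda> x \<in> greedy_approximants smul e N x"
        by (simp add: greedy_approximants_eq)
      have "norm (\<Sum>n\<in>A. smul 1 (e n)) \<le> K * norm (x - proj \<Lambda> x)"
        using A AB \<Lambda> by (intro K(2)) (auto simp: coeff_diff coeff_x proj_def coeff_sum)
      then have "u / K \<le> norm (x - proj \<Lambda> x)"
        using K(1) by (simp add: u_def divide_le_eq mult.commute)
      also have "\<dots> \<le> greedy_error smul e N x"
        by (rule norm_diff_le_greedy_error[OF N g])
      finally show ?thesis using True by (simp add: step_def)
    next
      case False
      then show ?thesis
        using greedy_error_attained[OF N, of x] by (auto simp: step_def)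
    qed
    define R where "R = b * (u * real n powr \<alpha> + 2 * v * real (2 * m) powr \<alpha>)"
    have "1 \<le> real n powr \<alpha>" "1 \<le> real (2 * m) powr \<alpha>"
      using n m \<alpha> by (auto intro!: ge_one_powr_ge_zero)
    then have "u * 1 + 2 * v * 1 \<le> u * real n powr \<alpha> + 2 * v * real (2 * m) powr \<alpha>"
      using u v by (intro add_mono mult_left_mono) auto
    also have "\<dots> \<le> R"
      using b u v mult_right_mono[of 1 b "u * real n powr \<alpha> + 2 * v * real (2 * m) powr \<alpha>"] by (simp add: R_def)
    finally have norm_x_R: "norm x \<le> R" using norm_x by simp
    have R: "0 \<le> R" using norm_x_R norm_ge_zero order_trans by blast
    have "weighted_lq \<alpha> q (\<lambda>N. best_error smul e N x) \<le>
        weighted_lq \<alpha> q (\<lambda>N. u * step n N + 2 * v * step (2 * m) N)"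
      using best by (intro weighted_lq_mono) (auto simp: best_error_nonneg)
    also have "\<dots> \<le> ennreal Q * (weighted_lq \<alpha> q (\<lambda>N. u * step n N) + weighted_lq \<alpha> q (\<lambda>N. 2 * v * step (2 * m) N))"
      using u v by (intro Q(2)) (auto simp: step_def)
    also have "\<dots> = ennreal Q * (ennreal u * weighted_lq \<alpha> q (step n) + ennreal (2 * v) * weighted_lq \<alpha> q (step (2 * m)))"
      using u v by (subst (1 2) weighted_lq_cmult[OF q]) (auto simp: step_def)
    also have "\<dots> \<le> ennreal Q * (ennreal u * ennreal (b * real n powr \<alpha>) +
        ennreal (2 * v) * ennreal (b * real (2 * m) powr \<alpha>))"
      using n m by (intro mult_left_mono add_mono upper) auto
    also have "\<dots> = ennreal (Q * R)"
      using u v b Q(1) by (simp add: R_def algebra_simps flip: ennreal_mult ennreal_plus)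
    finally have "approx_norm smul e \<alpha> q x \<le> ennreal R + ennreal (Q * R)"
      unfolding approx_norm_def using norm_x_R by (intro add_mono ennreal_leI) auto
    also have "\<dots> = ennreal ((1 + Q) * R)"
      using Q(1) R by (simp add: distrib_right)
    finally have approx: "approx_norm smul e \<alpha> q x \<le> ennreal ((1 + Q) * R)" .
    then have mem: "x \<in> approx_space smul e \<alpha> q"
      unfolding approx_space_def using le_less_trans ennreal_less_top by blast
    have "ennreal (u / K * (a * real m powr \<alpha>)) = ennreal (u / K) * ennreal (a * real m powr \<alpha>)"
      using u K(1) a by (intro ennreal_mult) auto
    also have "\<dots> \<le> ennreal (u / K) * weighted_lq \<alpha> q (step m)"
      by (intro mult_left_mono lower m) auto
    also have "\<dots> = weighted_lq \<alpha> q (\<lambda>N. u / K * step m N)"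
      using u K(1) by (intro weighted_lq_cmult[OF q, symmetric]) (auto simp: step_def)
    also have "\<dots> \<le> weighted_lq \<alpha> q (\<lambda>N. greedy_error smul e N x)"
      using greedy u K(1) by (intro weighted_lq_mono) (auto simp: step_def)
    also have "\<dots> \<le> greedy_norm smul e \<alpha> q x"
      by (simp add: greedy_norm_def)
    also have "\<dots> \<le> ennreal C0 * approx_norm smul e \<alpha> q x"
      by (rule C0[OF mem])
    also have "\<dots> \<le> ennreal C * ennreal ((1 + Q) * R)"
      using approx by (intro mult_mono ennreal_leI) (auto simp: C_def)
    also have "\<dots> = ennreal (C * ((1 + Q) * R))"
      using C Q(1) R by (intro ennreal_mult[symmetric]) auto
    finally have "u / K * (a * real m powr \<alpha>) \<le> C * ((1 + Q) * R)"
      using C Q(1) R by (subst (asm) ennreal_le_iff) auto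
    then have "u * a * real m powr \<alpha> \<le> E * (u * real n powr \<alpha> + 2 * v * real (2 * m) powr \<alpha>)"
      using K(1) by (simp add: E_def R_def field_simps)
    also have "\<dots> = u * (E * real n powr \<alpha>) + 2 * E * v * 2 powr \<alpha> * real m powr \<alpha>"
      by (simp add: powr_mult algebra_simps)
    also have "E * real n powr \<alpha> \<le> a / 2 * real m powr \<alpha>"
    proof -
      have "E * real n powr \<alpha> \<le> a / 2 * real k powr \<alpha> * real n powr \<alpha>"
        by (intro mult_right_mono kE) auto
      also have "\<dots> = a / 2 * real (k * n) powr \<alpha>"
        by (simp add: powr_mult)
      also have "\<dots> \<le> a / 2 * real m powr \<alpha>"
        using card a \<alpha> unfolding n_def m_def by (intro mult_left_mono powr_mono2) (auto simp flip: of_nat_mult)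
      finally show ?thesis .
    qed
    finally have "u * a * real m powr \<alpha> \<le> u * (a / 2 * real m powr \<alpha>) + 2 * E * v * 2 powr \<alpha> * real m powr \<alpha>"
      using u by (simp add: mult_left_mono)
    then have "(u * a) * real m powr \<alpha> \<le> (u * (a / 2) + 2 * E * v * 2 powr \<alpha>) * real m powr \<alpha>"
      by (simp add: algebra_simps)
    then have "u * a \<le> u * (a / 2) + 2 * E * v * 2 powr \<alpha>"
      using m by (subst (asm) mult_le_cancel_right) auto
    then show ?thesis
      using a by (simp add: u_def v_def field_simps)
  qed
  then have "norm (\<Sum>n\<in>A. e n) \<le> (4 * E * 2 powr \<alpha> / a) * norm (\<Sum>n\<in>B. e n)"
    if "finite A" "finite B" "A \<inter> B = {}" "k * card A \<le> card B" for A B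
    using that E a by (cases "A = {}") simp_all
  moreover have "0 \<le> 4 * E * 2 powr \<alpha> / a"
    using E a by simp
  ultimately show ?thesis
    using k1 by blast
qed

text \<open>
  For sets \<open>A\<close> and \<open>B\<close> of equal size \<open>m\<close>, the part of \<open>A\<close> in \<open>B\<close> is a projection of the sum over \<open>B\<close>.  The
  rest is disjoint from \<open>B\<close>; it is cut into pieces that are small enough to be compared with \<open>B\<close>.  If
  \<open>m < k\<close> no piece is small enough, but then the rest has norm at most \<open>k\<close>.
\<close>

lemma comparison_imp_democratic:
  assumes k: "1 \<le> k" and C: "0 \<le> C"
    and cmp: "\<And>A B. finite A \<Longrightarrow> finite B \<Longrightarrow> A \<inter> B = {} \<Longrightarrow> k * card A \<le> card B \<Longrightarrow>
     norm (\<Sum>n\<in>A. e n) \<le> C * norm (\<Sum>n\<in>B. e n)"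
  shows "democratic e"
proof -
  obtain K where K: "0 < K" "\<And>x F b. finite F \<Longrightarrow> (\<And>n. n \<in> F \<Longrightarrow> norm (b n) \<le> norm (coeff x n)) \<Longrightarrow>
      norm (\<Sum>n\<in>F. smul (b n) (e n)) \<le> K * norm x"
    using multiplier_constant by metis
  have sub: "norm (\<Sum>n\<in>S. e n) \<le> K * norm (\<Sum>n\<in>B. e n)" if "finite B" "S \<subseteq> B" for S B
    using K(2)[of S "\<lambda>_. 1" "\<Sum>n\<in>B. e n"] that finite_subset[OF that(2,1)]
    by (auto simp: coeff_sum_e subset_iff)
  have "norm (\<Sum>n\<in>A. e n) \<le> (K + real k * K + real (2 * k) * C) * norm (\<Sum>n\<in>B. e n)"
    if A: "finite A" and B: "finite B" and card: "card A = card B" for A B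
  proof -
    define m where "m = card B"
    define v where "v = norm (\<Sum>n\<in>B. e n)"
    have v: "0 \<le> v" by (simp add: v_def)
    have card_le: "card (A - B) \<le> m"
      using card_mono[OF A, of "A - B"] card by (auto simp: m_def)
    have rest: "norm (\<Sum>n\<in>A - B. e n) \<le> real k * K * v + real (2 * k) * C * v"
    proof (cases "m < k")
      case True
      have "norm (\<Sum>n\<in>A - B. e n) \<le> real (card (A - B))"
        by (rule order_trans[OF norm_sum]) (simp add: norm_e)
      also have "\<dots> \<le> real k * K * v"
      proof (cases "B = {}")
        case True
        then show ?thesis using card A K(1) v by (simp add: card_eq_0_iff)
      next
        case False
        then obtain i where "i \<in> B" by blast
        then have "1 \<le> K * v"
          using sub[OF B, of "{i}"] by (simp add: norm_e v_def)
        then have "real (card (A - B)) * 1 \<le> real k * (K * v)"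
          using card_le \<open>m < k\<close> by (intro mult_mono) auto
        then show ?thesis by (simp add: mult.assoc)
      qed
      finally show ?thesis
        using C v by (simp add: add_increasing2)
    next
      case False
      define n where "n = m div k"
      have n: "1 \<le> n"
        using False k by (simp add: n_def div_greater_zero_iff Suc_le_eq)
      have "m = k * n + m mod k" by (simp add: n_def)
      moreover have "m mod k < k" using k by simp
      moreover have "k \<le> k * n" using n by simp
      \<comment> \<open>Rounding down loses less than \<open>k\<close>, which is at most \<open>k * n\<close>; hence \<open>2 k\<close> pieces suffice.\<close>
      ultimately have "card (A - B) \<le> 2 * k * n" using card_le by linarith
      then have "norm (\<Sum>n\<in>A - B. e n) \<le> real (2 * k) * (C * v)"
      proof (intro norm_sum_le_by_pieces)
        fix G assume G: "G \<subseteq> A - B" "card G \<le> n"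
        have "k * card G \<le> k * n" using G(2) by simp
        also have "\<dots> \<le> card B" by (simp add: n_def m_def)
        finally show "norm (\<Sum>n\<in>G. e n) \<le> C * v"
          unfolding v_def using G A B finite_subset by (intro cmp) auto
      qed (use A in auto)
      then show ?thesis
        using K(1) v by (simp add: mult.assoc add_increasing)
    qed
    have "(\<Sum>n\<in>A. e n) = (\<Sum>n\<in>A \<inter> B. e n) + (\<Sum>n\<in>A - B. e n)"
      using A by (rule sum.Int_Diff)
    then show ?thesis
      using norm_triangle_ineq[of "\<Sum>n\<in>A \<inter> B. e n" "\<Sum>n\<in>A - B. e n"] rest sub[OF B, of "A \<inter> B"]
      by (simp add: v_def algebra_simps)
  qed
  then show ?thesis unfolding democratic_def by blast
qed

end

section \<open>Equivalence of democracy, near-best greedy approximation and the embeddings\<close>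

theorem theorem3p1:
  fixes smul :: "'k::{real_normed_field, euclidean_space} \<Rightarrow> 'a::banach \<Rightarrow> 'a"
    and e :: "nat \<Rightarrow> 'a"
  assumes "banach_over smul"
    and "normalised e"
    and "unconditional_basis smul e"
  shows "(democratic e \<longleftrightarrow>
            (\<exists>C::real. \<forall>x. \<forall>N\<ge>1. \<forall>g\<in>greedy_approximants smul e N x.
               norm (x - g) \<le> C * best_error smul e N x)) \<and>
         (democratic e \<longleftrightarrow> (\<forall>\<alpha>>0. \<forall>q>0. greedy_embeds smul e \<alpha> q)) \<and>
         (democratic e \<longleftrightarrow> (\<exists>\<alpha>>0. \<exists>q>0. greedy_embeds smul e \<alpha> q))"
proof -
  interpret banach_over smul by fact
  interpret normalised_unconditional_basis smul e
    using assms(2,3) by unfold_locales (auto simp: normalised_def)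
  let ?near = "\<exists>C::real. \<forall>x. \<forall>N\<ge>1. \<forall>g\<in>greedy_approximants smul e N x.
               norm (x - g) \<le> C * best_error smul e N x"
  let ?all = "\<forall>\<alpha>>0. \<forall>q>0. greedy_embeds smul e \<alpha> q"
  let ?some = "\<exists>\<alpha>>0. \<exists>q>0. greedy_embeds smul e \<alpha> q"
  have "democratic e \<Longrightarrow> ?near"
    using democratic_imp_near_best by blast
  moreover have "?near \<Longrightarrow> ?all"
    using near_best_imp_greedy_embeds by blast
  moreover have "?all \<Longrightarrow> ?some"
    by (meson zero_less_one)
  moreover have "?some \<Longrightarrow> democratic e"
    using greedy_embeds_imp_comparison comparison_imp_democratic by meson
  ultimately show ?thesis by argo
qed

end
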